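(* Assume $\rho>\xi(1-\sigma)$, and set $\alpha=\frac{\rho-\xi(1-\sigma)}{\sigma\xi}$ and $\nu=\alpha^{-\sigma}\frac1\xi$. Let $\Phi:\mathcal O\to\mathbb R$ be the feedback map $\Phi(x)=x^0-\alpha\Gamma(x)$, and let $x\in\mathcal O$ be an initial state with $x^0>0$ and $x^1>0$. If the unique solution $y(\cdot)$ of the closed-loop system $$y'(t)=\mathcal Ay(t)+\Phi(y(t))\,\tilde A\,\delta_{-d},\quad t\ge0,\qquad y(0)=x,$$ remains in $\mathcal O$ for all $t\ge0$, then the feedback control $u^*(t)=\Phi(y(t))$ is optimal starting at $x$, and the value function is given by $$V(x)=v(x):=\nu\,\frac{[\Gamma(x)]^{1-\sigma}}{1-\sigma}.$$
   Context: Constants: $A>0$, $\delta\ge0$, $\tilde A=A-\delta>0$, $d>0$, $\rho>0$, $\sigma>0$ with $\sigma\neq1$. $\xi$ is the unique positive real root of $z=\tilde Ae^{-zd}$. $X=\mathbb R\times L^2(-d,0;\mathbb R)$ with elements $x=(x^0,x^1)$ and inner product $\langle x,z\rangle_X=x^0z^0+\langle x^1,z^1\rangle_{L^2}$. $D(\mathcal A^* )=\{(\psi^0,\psi^1)\in X:\psi^1\in W^{1,2}([-d,0];\mathbb R),\ \psi^0=\psi^1(0)\}$, $\mathcal A^*(\psi^0,\psi^1)=(0,\frac d{ds}\psi^1)$; $\mathcal A$ is the adjoint of $\mathcal A^*$, viewed as an operator $X\to D(\mathcal A^* )'$. $\delta_{-d}\in D(\mathcal A^* )'$ is defined by $\delta_{-d}(\psi^0,\psi^1)=\psi^1(-d)$.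 $\Gamma(x)=x^0+\int_{-d}^0e^{\xi s}x^1(s)\,ds$, $\mathcal Q=\{x\in X:\Gamma(x)>0\}$, and $$\mathcal O=\left\{x=(x^0,x^1)\in\mathcal Q:\ \Gamma(x)<x^0\,\frac{A}{\alpha\tilde A}\right\}.$$ Control problem. For $x\in X$ and $u(\cdot)\in L^2_{\rm loc}([0,\infty);\mathbb R)$, $y^{x,u}(\cdot)=(y^0,y^1)(\cdot)$ is the unique solution of $y'(t)=\mathcal Ay(t)+u(t)\tilde A\delta_{-d}$, $y(0)=x$, in the class $\{f\in C([0,\infty);X):f'\in L^2_{\rm loc}(0,\infty;D(\mathcal A^* )')\}$; solutions of the closed-loop system are understood in the same class. (Equivalently, if $x=(q_0,\gamma_0)$ with $\gamma_0(s)=\tilde Au_0(-d-s)$, then $y^0=q$ with $q'(t)=\tilde Au(t-d)$, $q(0)=q_0$, $u=u_0$ on $[-d,0)$, and $y^1(t)(s)=\tilde Au(t-d-s)$.) Admissible controls: $$\mathcal U(x)=\Big\{u\in L^2_{\rm loc}([0,\infty);\mathbb R):\ u(t)\in\big[(1-\tfrac A{\tilde A})y^0(t),\,y^0(t)\big]\ \text{for all }t\ge0\ \text{(a.e.)}\Big\},$$ where admissibility in particular requires $y^0(t)\ge0$ for all $t\ge0$. Objective to be maximized: $J(x,u)=\int_0^\infty e^{-\rho t}\frac{(y^0(t)-u(t))^{1-\sigma}}{1-\sigma}\,dt$ (possibly $-\infty$ when $\sigma>1$); $V(x)=\sup_{u\in\mathcal U(x)}J(x,u)$; a control is optimal starting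 at $x$ if it is in $\mathcal U(x)$ and attains $V(x)$. *)

theory Defs
  imports "HOL-Analysis.Analysis"
begin

text \<open>Elements of \<open>L\<^sup>2(-d,0)\<close> are represented by functions \<open>real \<Rightarrow> real\<close>; only their values
  almost everywhere on \<open>[-d,0]\<close> matter. Accordingly, equality of states is equality almost
  everywhere of the second components.\<close>

type_synonym state = "real \<times> (real \<Rightarrow> real)"

definition L2_hist :: "real \<Rightarrow> (real \<Rightarrow> real) set" where
  "L2_hist d = {f. f \<in> borel_measurable (lebesgue_on {-d..0}) \<and>
                   integrable (lebesgue_on {-d..0}) (\<lambda>s. (f s)\<^sup>2)}"

definition X_space :: "real \<Rightarrow> state set" where
  "X_space d = UNIV \<times> L2_hist d"

definition innerX :: "real \<Rightarrow> state \<Rightarrow> state \<Rightarrow> real" where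
  "innerX d x z = fst x * fst z + (LINT s|lebesgue_on {-d..0}. snd x s * snd z s)"

definition distX :: "real \<Rightarrow> state \<Rightarrow> state \<Rightarrow> real" where
  "distX d x z = (let w = (fst x - fst z, \<lambda>s. snd x s - snd z s) in sqrt (innerX d w w))"

definition eqX :: "real \<Rightarrow> state \<Rightarrow> state \<Rightarrow> bool" where
  "eqX d x z \<longleftrightarrow> fst x = fst z \<and> (AE s in lebesgue_on {-d..0}. snd x s = snd z s)"

definition contX :: "real \<Rightarrow> (real \<Rightarrow> state) \<Rightarrow> bool" where
  "contX d y \<longleftrightarrow> (\<forall>t\<ge>0. y t \<in> X_space d) \<and>
     (\<forall>t\<ge>0. ((\<lambda>s. distX d (y s) (y t)) \<longlongrightarrow> 0) (at t within {0..}))"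

text \<open>\<open>W\<^sup>1\<^sup>,\<^sup>2([-d,0])\<close>, each class being represented by its absolutely continuous member, so that
  the boundary values at \<open>0\<close> and \<open>-d\<close> make sense. Such a function is differentiable almost
  everywhere, and its pointwise derivative \<open>deriv\<close> is (a representative of) its weak derivative.\<close>

definition W12 :: "real \<Rightarrow> (real \<Rightarrow> real) set" where
  "W12 d = {f. \<exists>g\<in>L2_hist d. \<forall>s\<in>{-d..0}. f s = f (-d) + (LINT r|lebesgue_on {-d..s}. g r)}"

definition dom_Astar :: "real \<Rightarrow> state set" where
  "dom_Astar d = {\<psi> \<in> X_space d. snd \<psi> \<in> W12 d \<and> fst \<psi> = snd \<psi> 0}"

definition Astar :: "state \<Rightarrow> state" where
  "Astar \<psi> = (0, deriv (snd \<psi>))"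

definition graph_norm :: "real \<Rightarrow> state \<Rightarrow> real" where
  "graph_norm d \<psi> = sqrt (innerX d \<psi> \<psi> + innerX d (Astar \<psi>) (Astar \<psi>))"

text \<open>The dual \<open>D(A\<^sup>*)'\<close>: functionals that are linear and bounded on \<open>D(A\<^sup>*)\<close> with its graph norm
  (values outside \<open>D(A\<^sup>*)\<close> are irrelevant). A state \<open>x\<close> is identified with the functional
  \<open>innerX d x\<close>.\<close>

definition dual_Astar :: "real \<Rightarrow> (state \<Rightarrow> real) set" where
  "dual_Astar d = {g.
     (\<forall>\<psi>\<in>dom_Astar d. \<forall>\<phi>\<in>dom_Astar d. \<forall>a b.
        g (a * fst \<psi> + b * fst \<phi>, \<lambda>s. a * snd \<psi> s + b * snd \<phi> s) = a * g \<psi> + b * g \<phi>) \<and>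
     (\<exists>C. \<forall>\<psi>\<in>dom_Astar d. \<bar>g \<psi>\<bar> \<le> C * graph_norm d \<psi>)}"

definition dual_norm :: "real \<Rightarrow> (state \<Rightarrow> real) \<Rightarrow> real" where
  "dual_norm d g = (SUP \<psi>\<in>{\<psi> \<in> dom_Astar d. graph_norm d \<psi> \<le> 1}. \<bar>g \<psi>\<bar>)"

definition opA :: "real \<Rightarrow> state \<Rightarrow> (state \<Rightarrow> real)" where
  "opA d x = (\<lambda>\<psi>. innerX d x (Astar \<psi>))"

definition delta_md :: "real \<Rightarrow> (state \<Rightarrow> real)" where
  "delta_md d = (\<lambda>\<psi>. snd \<psi> (-d))"

text \<open>\<open>L\<^sup>2\<^sub>l\<^sub>o\<^sub>c(0,\<infinity>; D(A\<^sup>*)')\<close>. As \<open>D(A\<^sup>*)\<close> is a separable Hilbert space, strong measurability amounts to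
  measurability of all evaluations at elements of \<open>D(A\<^sup>*)\<close>.\<close>

definition L2loc_dual :: "real \<Rightarrow> (real \<Rightarrow> state \<Rightarrow> real) set" where
  "L2loc_dual d = {h.
     (AE t in lebesgue_on {0<..}. h t \<in> dual_Astar d) \<and>
     (\<forall>\<psi>\<in>dom_Astar d. (\<lambda>t. h t \<psi>) \<in> borel_measurable (lebesgue_on {0<..})) \<and>
     (\<forall>a b. 0 < a \<and> a \<le> b \<longrightarrow> integrable (lebesgue_on {a..b}) (\<lambda>t. (dual_norm d (h t))\<^sup>2))}"

text \<open>\<open>h\<close> is the derivative of \<open>y\<close> as a \<open>D(A\<^sup>*)'\<close>-valued function:
  \<open>y(b) - y(a) = \<integral>\<^sub>a\<^sup>b h(t) dt\<close> in \<open>D(A\<^sup>*)'\<close> for \<open>0 < a \<le> b\<close>.\<close>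

definition has_deriv_dual ::
    "real \<Rightarrow> (real \<Rightarrow> state) \<Rightarrow> (real \<Rightarrow> state \<Rightarrow> real) \<Rightarrow> bool" where
  "has_deriv_dual d y h \<longleftrightarrow> (\<forall>\<psi>\<in>dom_Astar d. \<forall>a b. 0 < a \<and> a \<le> b \<longrightarrow>
     innerX d (y b) \<psi> - innerX d (y a) \<psi> = (LINT t|lebesgue_on {a..b}. h t \<psi>))"

text \<open>Solutions of \<open>y' = \<A>y + u At \<delta>\<^sub>-\<^sub>d\<close>, \<open>y(0) = x\<close>, in the class of \<open>f \<in> C([0,\<infinity>);X)\<close> with
  \<open>f' \<in> L\<^sup>2\<^sub>l\<^sub>o\<^sub>c(0,\<infinity>;D(A\<^sup>*)')\<close>; the equation holds in \<open>D(A\<^sup>*)'\<close> for almost every \<open>t\<close>.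
  Throughout, \<open>At\<close> is \<open>A - \<delta>\<close>.\<close>

definition solves :: "real \<Rightarrow> real \<Rightarrow> state \<Rightarrow> (real \<Rightarrow> real) \<Rightarrow> (real \<Rightarrow> state) \<Rightarrow> bool" where
  "solves d At x u y \<longleftrightarrow> contX d y \<and> eqX d (y 0) x \<and>
     (\<exists>h\<in>L2loc_dual d. has_deriv_dual d y h \<and>
        (AE t in lebesgue_on {0..}. \<forall>\<psi>\<in>dom_Astar d.
           h t \<psi> = opA d (y t) \<psi> + u t * At * delta_md d \<psi>))"

definition L2loc :: "(real \<Rightarrow> real) set" where
  "L2loc = {u. u \<in> borel_measurable (lebesgue_on {0..}) \<and>
               (\<forall>T\<ge>0. integrable (lebesgue_on {0..T}) (\<lambda>t. (u t)\<^sup>2))}"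

text \<open>\<open>y\<^sup>x\<^sup>,\<^sup>u\<close>; the solution is unique up to the identification \<open>eqX\<close>, and its first component is
  unique on \<open>[0,\<infinity>)\<close>.\<close>

definition trajectory :: "real \<Rightarrow> real \<Rightarrow> state \<Rightarrow> (real \<Rightarrow> real) \<Rightarrow> (real \<Rightarrow> state)" where
  "trajectory d At x u = (SOME y. solves d At x u y)"

text \<open>A solution exists for every \<open>u \<in> L2loc\<close> and its first component is unique, so the existential
  quantifier over \<open>y\<close> only serves to name \<open>y\<^sup>x\<^sup>,\<^sup>u\<close>.\<close>

definition admissible :: "real \<Rightarrow> real \<Rightarrow> real \<Rightarrow> state \<Rightarrow> (real \<Rightarrow> real) set" where
  "admissible d A At x = {u \<in> L2loc. \<exists>y. solves d At x u y \<and>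
     (\<forall>t\<ge>0. 0 \<le> fst (y t)) \<and>
     (AE t in lebesgue_on {0..}. u t \<in> {(1 - A / At) * fst (y t) .. fst (y t)})}"

text \<open>\<open>c\<^sup>1\<^sup>-\<^sup>\<sigma> / (1 - \<sigma>)\<close> for \<open>c \<ge> 0\<close>, with value \<open>-\<infinity>\<close> at \<open>c = 0\<close> if \<open>\<sigma> > 1\<close>
  (where \<open>powr\<close> would give \<open>0\<close>).\<close>

definition utility :: "real \<Rightarrow> real \<Rightarrow> ereal" where
  "utility \<sigma> c = (if c = 0 \<and> \<sigma> > 1 then -\<infinity> else ereal (c powr (1 - \<sigma>) / (1 - \<sigma>)))"

text \<open>Integral of an extended-real function as the difference of the integrals of its positive and
  negative parts (\<open>e2ennreal\<close> truncates negative values to \<open>0\<close>). In \<open>objective\<close> the integrand has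
  constant sign, so one of the two terms vanishes.\<close>

definition ereal_integral :: "'a measure \<Rightarrow> ('a \<Rightarrow> ereal) \<Rightarrow> ereal" where
  "ereal_integral M f = enn2ereal (\<integral>\<^sup>+ t. e2ennreal (f t) \<partial>M) -
                        enn2ereal (\<integral>\<^sup>+ t. e2ennreal (- f t) \<partial>M)"

definition objective ::
    "real \<Rightarrow> real \<Rightarrow> real \<Rightarrow> real \<Rightarrow> state \<Rightarrow> (real \<Rightarrow> real) \<Rightarrow> ereal" where
  "objective d At \<rho> \<sigma> x u = ereal_integral (lebesgue_on {0..})
     (\<lambda>t. ereal (exp (- \<rho> * t)) * utility \<sigma> (fst (trajectory d At x u t) - u t))"

definition value_fun :: "real \<Rightarrow> real \<Rightarrow> real \<Rightarrow> real \<Rightarrow> real \<Rightarrow> state \<Rightarrow> ereal" where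
  "value_fun d A At \<rho> \<sigma> x = (SUP u\<in>admissible d A At x. objective d At \<rho> \<sigma> x u)"

definition optimal ::
    "real \<Rightarrow> real \<Rightarrow> real \<Rightarrow> real \<Rightarrow> real \<Rightarrow> state \<Rightarrow> (real \<Rightarrow> real) \<Rightarrow> bool" where
  "optimal d A At \<rho> \<sigma> x u \<longleftrightarrow>
     u \<in> admissible d A At x \<and> objective d At \<rho> \<sigma> x u = value_fun d A At \<rho> \<sigma> x"

definition Gam :: "real \<Rightarrow> real \<Rightarrow> state \<Rightarrow> real" where
  "Gam d \<xi> x = fst x + (LINT s|lebesgue_on {-d..0}. exp (\<xi> * s) * snd x s)"

definition Q_set :: "real \<Rightarrow> real \<Rightarrow> state set" where
  "Q_set d \<xi> = {x \<in> X_space d. Gam d \<xi> x > 0}"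

definition O_set :: "real \<Rightarrow> real \<Rightarrow> real \<Rightarrow> real \<Rightarrow> real \<Rightarrow> state set" where
  "O_set d A At \<xi> \<alpha> = {x \<in> Q_set d \<xi>. Gam d \<xi> x < fst x * (A / (\<alpha> * At))}"

definition feedback :: "real \<Rightarrow> real \<Rightarrow> real \<Rightarrow> state \<Rightarrow> real" where
  "feedback d \<xi> \<alpha> x = fst x - \<alpha> * Gam d \<xi> x"

end

theory Submission
  imports Defs
begin

text \<open>The functional \<open>\<Gamma>\<close> pairs a state with \<open>(1, exp (\<xi> s))\<close>, and \<open>\<xi> = At exp (-\<xi> d)\<close> turns the state
  equation into \<open>d/dt \<Gamma>(y) = \<xi> (\<Gamma>(y) - c)\<close>, where \<open>c = y\<^sup>0 - u\<close> is consumption. Since \<open>\<Gamma>\<close> stays nonnegative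
  along admissible trajectories, \<open>\<integral> exp (-\<xi> t) c(t) dt \<le> \<Gamma>(x) / \<xi>\<close>, with equality for the feedback control,
  whose consumption is \<open>\<alpha> \<Gamma>(x) exp (\<xi> (1 - \<alpha>) t)\<close>. As the discounted marginal utility along that path is
  a multiple of \<open>exp (-\<xi> t)\<close>, concavity of the utility shows that it is optimal.

  Nonnegativity of \<open>\<Gamma>\<close>, and uniqueness of \<open>y\<^sup>0\<close>, depend on the finite delay. They come from testing the
  equation with functions transported along the characteristics, which reduces by Weierstrass
  approximation to the exponentials \<open>exp (k s)\<close>, where only scalar equations are needed.\<close>

section \<open>Integration on intervals\<close>

text \<open>Since \<open>A / At\<close> is at least 1, admissible controls may be negative and
  \<open>y\<^sup>1\<close> may change sign, so the sign of \<open>Gam\<close> cannot be read off the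
  current state; what forces it is the constraint that \<open>y\<^sup>0\<close> stay nonnegative
  during the next \<open>d\<close> units of time. The explicit shift formula for
  \<open>y\<^sup>1\<close> would show this, but a solution is given only through the equation tested
  against fixed elements of \<open>dom_Astar\<close>. An exponential turns the tested equation into
  a scalar one for \<open>Gam d k\<close>, and the identity for transported test functions is linear
  in the pair of the function and its derivative; it therefore extends from exponentials by density
  in the C1 norm. As the control is merely locally square integrable, the scalar equations hold only
  in integrated form, whence a product rule for indefinite integrals in place of
  differentiation.\<close>

lemma integrable_continuous_mult:
  fixes f g :: "real \<Rightarrow> real"
  assumes "continuous_on {a..b} g" and "integrable (lebesgue_on {a..b}) f"
  shows "integrable (lebesgue_on {a..b}) (\<lambda>x. g x * f x)"
proof -
  have "bounded (g ` {a..b})"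
    using assms(1) compact_Icc compact_continuous_image compact_imp_bounded by blast
  moreover have "g \<in> borel_measurable (lebesgue_on {a..b})"
    using assms(1) by (intro continuous_imp_measurable_on_sets_lebesgue) auto
  moreover have "f absolutely_integrable_on {a..b}"
    using assms(2) by (simp add: integrable_restrict_space set_integrable_def)
  ultimately show ?thesis
    by (intro absolutely_integrable_imp_integrable absolutely_integrable_bounded_measurable_product_real) auto
qed

lemma integral_continuous_mult_bound:
  fixes f g :: "real \<Rightarrow> real"
  assumes "continuous_on {a..b} g" and "integrable (lebesgue_on {a..b}) f"
    and "\<And>x. x \<in> {a..b} \<Longrightarrow> \<bar>g x\<bar> \<le> e"
  shows "\<bar>LINT x|lebesgue_on {a..b}. g x * f x\<bar> \<le> e * (LINT x|lebesgue_on {a..b}. \<bar>f x\<bar>)"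
proof -
  have "\<bar>LINT x|lebesgue_on {a..b}. g x * f x\<bar> \<le> (LINT x|lebesgue_on {a..b}. \<bar>g x * f x\<bar>)"
    by (rule integral_abs_bound)
  also have "\<dots> \<le> (LINT x|lebesgue_on {a..b}. e * \<bar>f x\<bar>)"
    using assms integrable_continuous_mult[OF assms(1,2)]
    by (intro integral_mono integrable_abs) (auto simp: abs_mult intro!: mult_right_mono)
  finally show ?thesis by simp
qed

text \<open>Dividing by \<open>t - s\<close> bounds the difference quotients of \<open>D\<close> by
  increments of the continuous \<open>\<Gamma>\<close>, so \<open>D\<close> has derivative zero
  everywhere. In the product rule below, \<open>\<Gamma>\<close> is the running integral of
  \<open>\<bar>g\<bar>\<close>.\<close>

lemma increment_bound_imp_eq:
  fixes D \<Gamma> :: "real \<Rightarrow> real"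
  assumes "a \<le> b" and "C \<ge> 0" and cont: "continuous_on {a..b} \<Gamma>"
    and incr: "\<And>s t. a \<le> s \<Longrightarrow> s \<le> t \<Longrightarrow> t \<le> b \<Longrightarrow> \<bar>D t - D s\<bar> \<le> C * (t - s) * (\<Gamma> t - \<Gamma> s)"
  shows "D b = D a"
proof -
  have "(D has_real_derivative 0) (at x within {a..b})" if x: "x \<in> {a..b}" for x
  proof -
    have "((\<lambda>z. C * \<bar>\<Gamma> z - \<Gamma> x\<bar>) \<longlongrightarrow> C * \<bar>\<Gamma> x - \<Gamma> x\<bar>) (at x within {a..b})"
      using cont x by (intro tendsto_intros) (simp add: continuous_on)
    then have lim: "((\<lambda>z. C * \<bar>\<Gamma> z - \<Gamma> x\<bar>) \<longlongrightarrow> 0) (at x within {a..b})" by simp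
    have le: "C * (t - s) * (\<Gamma> t - \<Gamma> s) \<le> C * (t - s) * \<bar>\<Gamma> t - \<Gamma> s\<bar>" if "s \<le> t" for s t
      using that \<open>C \<ge> 0\<close> by (intro mult_left_mono) auto
    have bd: "\<bar>(D z - D x) / (z - x)\<bar> \<le> C * \<bar>\<Gamma> z - \<Gamma> x\<bar>" if z: "z \<in> {a..b}" "z \<noteq> x" for z
    proof -
      have "\<bar>D z - D x\<bar> \<le> C * \<bar>z - x\<bar> * \<bar>\<Gamma> z - \<Gamma> x\<bar>"
      proof (cases "x \<le> z")
        case True
        then show ?thesis using incr[of x z] le[of x z] x z by auto
      next
        case False
        then show ?thesis using incr[of z x] le[of z x] x z
          by (auto simp: abs_minus_commute[of _ "D x"] abs_minus_commute[of _ "\<Gamma> x"])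
      qed
      then show ?thesis using z(2) by (simp add: abs_divide divide_le_eq mult_ac)
    qed
    have "((\<lambda>z. (D z - D x) / (z - x)) \<longlongrightarrow> 0) (at x within {a..b})"
      by (rule Lim_null_comparison[OF _ lim]) (use bd in \<open>auto simp: eventually_at_filter\<close>)
    then show ?thesis by (simp add: has_field_derivative_iff)
  qed
  then obtain c where "\<And>x. x \<in> {a..b} \<Longrightarrow> D x = c"
    using has_field_derivative_zero_constant[of "{a..b}" D] by auto
  then show ?thesis using \<open>a \<le> b\<close> by auto
qed

lemma LINT_FTC:
  fixes F f :: "real \<Rightarrow> real"
  assumes "a \<le> b" and "\<And>x. x \<in> {a..b} \<Longrightarrow> (F has_real_derivative f x) (at x within {a..b})"
    and "continuous_on {a..b} f"
  shows "(LINT x|lebesgue_on {a..b}. f x) = F b - F a"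
proof -
  have "(f has_integral (F b - F a)) {a..b}"
    using assms by (intro fundamental_theorem_of_calculus)
      (auto simp: has_real_derivative_iff_has_vector_derivative[symmetric])
  then show ?thesis
    using assms(3) by (simp add: continuous_imp_integrable_real integral_unique lebesgue_integral_eq_integral)
qed

text \<open>As \<open>g\<close> is merely integrable, \<open>\<phi>\<close> need not be differentiable everywhere. Instead, the increments
  of the two sides, as functions of \<open>b\<close>, differ by a second order term.\<close>

lemma integral_product_rule:
  fixes \<phi> g m m' :: "real \<Rightarrow> real"
  assumes "a \<le> b" and g: "integrable (lebesgue_on {a..b}) g"
    and \<phi>: "\<And>s t. a \<le> s \<Longrightarrow> s \<le> t \<Longrightarrow> t \<le> b \<Longrightarrow> \<phi> t - \<phi> s = (LINT w|lebesgue_on {s..t}. g w)"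
    and m: "\<And>t. t \<in> {a..b} \<Longrightarrow> (m has_real_derivative m' t) (at t within {a..b})"
    and m': "continuous_on {a..b} m'"
  shows "m b * \<phi> b - m a * \<phi> a = (LINT w|lebesgue_on {a..b}. m' w * \<phi> w + m w * g w)"
proof -
  define \<Gamma> where "\<Gamma> t = (LINT w|lebesgue_on {a..t}. \<bar>g w\<bar>)" for t
  define I where "I t = (LINT w|lebesgue_on {a..t}. g w)" for t
  have cont\<Gamma>: "continuous_on {a..b} \<Gamma>"
    unfolding \<Gamma>_def using g by (intro indefinite_integral_continuous_real) auto
  have "continuous_on {a..b} (\<lambda>t. \<phi> a + I t)"
    unfolding I_def using g by (intro continuous_intros indefinite_integral_continuous_real) auto
  moreover have "\<phi> t = \<phi> a + I t" if "t \<in> {a..b}" for t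
    using \<phi>[of a t] that by (simp add: I_def)
  ultimately have cont\<phi>: "continuous_on {a..b} \<phi>"
    by (metis (no_types, lifting) continuous_on_cong)
  have contm: "continuous_on {a..b} m"
    using m by (meson DERIV_continuous_on)
  obtain M0 where M0: "\<And>t. t \<in> {a..b} \<Longrightarrow> \<bar>m' t\<bar> \<le> M0"
    using compact_imp_bounded[OF compact_continuous_image[OF m' compact_Icc]]
    unfolding bounded_iff by (metis image_eqI real_norm_def)
  define M where "M = max M0 0"
  have M: "\<And>t. t \<in> {a..b} \<Longrightarrow> \<bar>m' t\<bar> \<le> M" "M \<ge> 0"
    using M0 by (force simp: M_def)+
  let ?h = "\<lambda>w. m' w * \<phi> w + m w * g w"
  have inth: "integrable (lebesgue_on {a..b}) ?h"
    by (intro Bochner_Integration.integrable_add integrable_continuous_mult contm g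
        continuous_imp_integrable_real continuous_intros m' cont\<phi>)
  define D where "D t = m t * \<phi> t - (LINT w|lebesgue_on {a..t}. ?h w)" for t
  have "D b = D a"
  proof (rule increment_bound_imp_eq[OF \<open>a \<le> b\<close> _ cont\<Gamma>, of "2 * M"])
    fix s t assume st: "a \<le> s" "s \<le> t" "t \<le> b"
    have sub: "{s..t} \<subseteq> {a..b}" and sub': "{a..t} \<subseteq> {a..b}" using st by auto
    note cs = continuous_on_subset[OF _ sub]
    have gst: "integrable (lebesgue_on {s..t}) g" using integrable_subinterval[OF g sub] .
    have \<Gamma>st: "\<Gamma> v - \<Gamma> u = (LINT w|lebesgue_on {u..v}. \<bar>g w\<bar>)" if "a \<le> u" "u \<le> v" "v \<le> b" for u v
      using Equivalence_Measurable_On_Borel.integral_combine[of a v "\<lambda>w. \<bar>g w\<bar>" u] that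
        integrable_subinterval[OF integrable_abs[OF g], of a v] by (simp add: \<Gamma>_def)
    have hst: "(LINT w|lebesgue_on {a..t}. ?h w) - (LINT w|lebesgue_on {a..s}. ?h w)
        = (LINT w|lebesgue_on {s..t}. ?h w)"
      using Equivalence_Measurable_On_Borel.integral_combine[of a t ?h s] st
        integrable_subinterval[OF inth sub'] by simp
    have mst: "m t - m s = (LINT w|lebesgue_on {s..t}. m' w)"
      using st by (intro LINT_FTC[symmetric]) (auto intro!: cs m' DERIV_subset[OF m _])
    \<comment> \<open>Freezing \<open>\<phi>\<close> at the right end and \<open>m\<close> at the
      left end leaves only the small factors \<open>\<phi> t - \<phi> w\<close> and
      \<open>m s - m w\<close>. Each of the two products integrates to at most
      \<open>M * (t - s) * (\<Gamma> t - \<Gamma> s)\<close>, hence the constant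
      \<open>2 * M\<close>.\<close>
    have "D t - D s = (m t - m s) * \<phi> t + m s * (\<phi> t - \<phi> s) - (LINT w|lebesgue_on {s..t}. ?h w)"
      unfolding D_def hst[symmetric] by (simp add: algebra_simps)
    also have "\<dots> = (LINT w|lebesgue_on {s..t}. \<phi> t * m' w + m s * g w - ?h w)"
      unfolding mst \<phi>[OF st]
      using integrable_subinterval[OF inth sub] gst continuous_imp_integrable_real[OF cs[OF m']]
      by (simp add: mult.commute)
    also have "\<dots> = (LINT w|lebesgue_on {s..t}. m' w * (\<phi> t - \<phi> w) + (m s - m w) * g w)"
      by (simp add: algebra_simps)
    finally have "\<bar>D t - D s\<bar> \<le> (LINT w|lebesgue_on {s..t}. \<bar>m' w * (\<phi> t - \<phi> w) + (m s - m w) * g w\<bar>)"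
      using integral_abs_bound by metis
    also have "\<dots> \<le> (LINT w|lebesgue_on {s..t}. M * (\<Gamma> t - \<Gamma> s) + M * (t - s) * \<bar>g w\<bar>)"
    proof (rule integral_mono)
      show "integrable (lebesgue_on {s..t}) (\<lambda>w. \<bar>m' w * (\<phi> t - \<phi> w) + (m s - m w) * g w\<bar>)"
        by (intro integrable_abs Bochner_Integration.integrable_add integrable_continuous_mult gst
          continuous_imp_integrable_real continuous_intros cs m' cont\<phi> contm)
      show "integrable (lebesgue_on {s..t}) (\<lambda>w. M * (\<Gamma> t - \<Gamma> s) + M * (t - s) * \<bar>g w\<bar>)"
        using gst by auto
      fix w assume "w \<in> space (lebesgue_on {s..t})"
      then have w: "w \<in> {s..t}" by simp
      have "\<bar>\<phi> t - \<phi> w\<bar> \<le> \<Gamma> t - \<Gamma> w"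
        using \<phi>[of w t] \<Gamma>st[of w t] w st integral_abs_bound[of "lebesgue_on {w..t}" g] by auto
      moreover have "\<Gamma> s \<le> \<Gamma> w"
      proof -
        have "0 \<le> (LINT v|lebesgue_on {s..w}. \<bar>g v\<bar>)" by (intro integral_nonneg_AE) auto
        moreover have "\<Gamma> w - \<Gamma> s = (LINT v|lebesgue_on {s..w}. \<bar>g v\<bar>)" using \<Gamma>st[of s w] w st by simp
        ultimately show ?thesis by linarith
      qed
      ultimately have 1: "\<bar>\<phi> t - \<phi> w\<bar> \<le> \<Gamma> t - \<Gamma> s" by simp
      have "m w - m s = (LINT w|lebesgue_on {s..w}. m' w)"
        using st w by (intro LINT_FTC[symmetric]) (auto intro!: continuous_on_subset[OF m'] DERIV_subset[OF m _])
      moreover have "\<bar>LINT v|lebesgue_on {s..w}. m' v\<bar> \<le> M * (LINT v|lebesgue_on {s..w}. \<bar>1::real\<bar>)"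
        using integral_continuous_mult_bound[of s w m' "\<lambda>_. 1" M] w st M(1)
          continuous_on_subset[OF m', of "{s..w}"] by auto
      moreover have "(LINT v|lebesgue_on {s..w}. \<bar>1::real\<bar>) = w - s"
        using LINT_FTC[of s w "\<lambda>x. x" "\<lambda>_. 1"] w by auto
      ultimately have "\<bar>m s - m w\<bar> \<le> M * (w - s)"
        by (simp add: abs_minus_commute)
      also have "\<dots> \<le> M * (t - s)" using w M(2) by (intro mult_left_mono) auto
      finally have 2: "\<bar>m s - m w\<bar> \<le> M * (t - s)" .
      have "\<bar>m' w * (\<phi> t - \<phi> w) + (m s - m w) * g w\<bar> \<le> \<bar>m' w\<bar> * \<bar>\<phi> t - \<phi> w\<bar> + \<bar>m s - m w\<bar> * \<bar>g w\<bar>"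
        by (metis abs_mult abs_triangle_ineq)
      also have "\<dots> \<le> M * (\<Gamma> t - \<Gamma> s) + M * (t - s) * \<bar>g w\<bar>"
        using 1 2 M w sub by (intro add_mono mult_mono) auto
      finally show "\<bar>m' w * (\<phi> t - \<phi> w) + (m s - m w) * g w\<bar> \<le> M * (\<Gamma> t - \<Gamma> s) + M * (t - s) * \<bar>g w\<bar>" .
    qed
    also have "\<dots> = M * (\<Gamma> t - \<Gamma> s) * (LINT v|lebesgue_on {s..t}. 1) + M * (t - s) * (\<Gamma> t - \<Gamma> s)"
      using gst \<Gamma>st[OF st] by simp
    also have "(LINT v|lebesgue_on {s..t}. 1) = t - s"
      using LINT_FTC[of s t "\<lambda>x. x" "\<lambda>_. 1"] st by auto
    finally show "\<bar>D t - D s\<bar> \<le> 2 * M * (t - s) * (\<Gamma> t - \<Gamma> s)"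
      by (simp add: algebra_simps)
  qed (use M in auto)
  moreover have "(LINT w|lebesgue_on {a..a}. ?h w) = 0"
    using LINT_FTC[of a a "\<lambda>_. 0" "\<lambda>_. 0"] by (simp add: integral_eq_zero_null_sets)
  ultimately show ?thesis by (simp add: D_def)
qed

section \<open>States and exponential test functions\<close>

lemma square_integrable_imp_integrable:
  fixes f :: "real \<Rightarrow> real"
  assumes "f \<in> borel_measurable (lebesgue_on {a..b})"
    and "integrable (lebesgue_on {a..b}) (\<lambda>s. (f s)\<^sup>2)"
  shows "integrable (lebesgue_on {a..b}) f"
proof (rule Bochner_Integration.integrable_bound[of _ "\<lambda>s. 1 + (f s)\<^sup>2"])
  have "\<bar>f s\<bar> \<le> 1 + (f s)\<^sup>2" for s
    using zero_le_power2[of "\<bar>f s\<bar> - 1"] by (simp add: power2_diff)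
  then show "AE s in lebesgue_on {a..b}. norm (f s) \<le> norm (1 + (f s)\<^sup>2)" by auto
qed (use assms in auto)

lemma L2_hist_integrable: "f \<in> L2_hist d \<Longrightarrow> integrable (lebesgue_on {-d..0}) f"
  unfolding L2_hist_def by (rule square_integrable_imp_integrable) auto

lemma continuous_L2_hist:
  assumes "continuous_on {-d..0} g" shows "g \<in> L2_hist d"
proof -
  have "g \<in> borel_measurable (lebesgue_on {-d..0})"
    by (intro continuous_imp_measurable_on_sets_lebesgue assms) simp
  moreover have "integrable (lebesgue_on {-d..0}) (\<lambda>s. (g s)\<^sup>2)"
    by (intro continuous_imp_integrable_real continuous_on_power assms)
  ultimately show ?thesis by (simp add: L2_hist_def)
qed

lemma L2_hist_diff:
  assumes f: "f \<in> L2_hist d" and g: "g \<in> L2_hist d"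
  shows "(\<lambda>s. f s - g s) \<in> L2_hist d"
proof -
  have "integrable (lebesgue_on {-d..0}) (\<lambda>s. (f s - g s)\<^sup>2)"
  proof (rule Bochner_Integration.integrable_bound[of _ "\<lambda>s. 2 * (f s)\<^sup>2 + 2 * (g s)\<^sup>2"])
    have "(f s - g s)\<^sup>2 \<le> 2 * (f s)\<^sup>2 + 2 * (g s)\<^sup>2" for s
      using zero_le_power2[of "f s + g s"] by (simp add: power2_diff power2_sum)
    then show "AE s in lebesgue_on {-d..0}. norm ((f s - g s)\<^sup>2) \<le> norm (2 * (f s)\<^sup>2 + 2 * (g s)\<^sup>2)"
      by auto
  qed (use f g in \<open>auto simp: L2_hist_def\<close>)
  then show ?thesis using f g by (auto simp: L2_hist_def)
qed

text \<open>Cauchy-Schwarz against the constant 1, obtained from the nonnegativity of the variance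
  of \<open>\<bar>f s\<bar>\<close> about its mean \<open>I / d\<close>.\<close>

lemma L1_le_L2:
  assumes "d > 0" and f: "f \<in> L2_hist d"
  shows "(LINT s|lebesgue_on {-d..0}. \<bar>f s\<bar>) \<le> sqrt d * sqrt (LINT s|lebesgue_on {-d..0}. (f s)\<^sup>2)"
proof -
  let ?M = "lebesgue_on {-d..0}"
  define I where "I = (LINT s|?M. \<bar>f s\<bar>)"
  define J where "J = (LINT s|?M. (f s)\<^sup>2)"
  have int: "integrable ?M (\<lambda>s. \<bar>f s\<bar>)" "integrable ?M (\<lambda>s. (f s)\<^sup>2)"
    using f L2_hist_integrable[OF f] by (auto simp: L2_hist_def)
  have one: "(LINT s|?M. 1) = d"
    using LINT_FTC[of "-d" 0 "\<lambda>x. x" "\<lambda>_. 1"] \<open>d > 0\<close> by auto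
  have "0 \<le> (LINT s|?M. (\<bar>f s\<bar> - I / d)\<^sup>2)" by (intro integral_nonneg_AE) auto
  also have "\<dots> = (LINT s|?M. (f s)\<^sup>2 - 2 * (I / d) * \<bar>f s\<bar> + (I / d)\<^sup>2 * 1)"
    by (simp add: power2_diff algebra_simps)
  also have "\<dots> = J - 2 * (I / d) * I + (I / d)\<^sup>2 * (LINT s|?M. 1)"
    using int by (simp add: I_def J_def)
  also have "\<dots> = J - I\<^sup>2 / d"
    unfolding one using \<open>d > 0\<close> by (simp add: field_simps power2_eq_square)
  finally have "I\<^sup>2 \<le> d * J" using \<open>d > 0\<close> by (simp add: field_simps)
  then show ?thesis
    by (metis I_def J_def real_le_rsqrt real_sqrt_mult)
qed

lemma distX_eq:
  "distX d x z = sqrt ((fst x - fst z)\<^sup>2 + (LINT s|lebesgue_on {-d..0}. (snd x s - snd z s)\<^sup>2))"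
  by (simp add: distX_def innerX_def power2_eq_square)

lemma fst_diff_le_distX: "\<bar>fst x - fst z\<bar> \<le> distX d x z"
proof -
  have "0 \<le> (LINT s|lebesgue_on {-d..0}. (snd x s - snd z s)\<^sup>2)" by (intro integral_nonneg_AE) auto
  then show ?thesis unfolding distX_eq by (intro real_le_rsqrt) simp
qed

lemma pairing_diff_le_distX:
  assumes "d > 0" and x: "x \<in> X_space d" and z: "z \<in> X_space d"
    and g: "continuous_on {-d..0} g" and M: "\<And>s. s \<in> {-d..0} \<Longrightarrow> \<bar>g s\<bar> \<le> M" "M \<ge> 0"
  shows "\<bar>(LINT s|lebesgue_on {-d..0}. g s * snd x s) - (LINT s|lebesgue_on {-d..0}. g s * snd z s)\<bar>
         \<le> M * (sqrt d * distX d x z)"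
proof -
  have L2: "snd x \<in> L2_hist d" "snd z \<in> L2_hist d" using x z by (auto simp: X_space_def)
  note diff = L2_hist_diff[OF L2]
  have "(LINT s|lebesgue_on {-d..0}. g s * snd x s) - (LINT s|lebesgue_on {-d..0}. g s * snd z s)
      = (LINT s|lebesgue_on {-d..0}. g s * (snd x s - snd z s))"
    using L2 by (simp add: right_diff_distrib integrable_continuous_mult[OF g] L2_hist_integrable)
  also have "\<bar>\<dots>\<bar> \<le> M * (LINT s|lebesgue_on {-d..0}. \<bar>snd x s - snd z s\<bar>)"
    by (rule integral_continuous_mult_bound[OF g L2_hist_integrable[OF diff] M(1)])
  also have "(LINT s|lebesgue_on {-d..0}. \<bar>snd x s - snd z s\<bar>)
      \<le> sqrt d * sqrt (LINT s|lebesgue_on {-d..0}. (snd x s - snd z s)\<^sup>2)"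
    using L1_le_L2[OF \<open>d > 0\<close> diff] .
  also have "\<dots> \<le> sqrt d * distX d x z"
    unfolding distX_eq using \<open>d > 0\<close> by (intro mult_left_mono) auto
  finally show ?thesis using M(2) by (simp add: mult_left_mono)
qed

text \<open>The first component is the boundary value \<open>exp (k * 0) = 1\<close> that
  \<open>dom_Astar\<close> prescribes.\<close>

lemma exp_in_dom_Astar:
  assumes "d > 0" shows "(1, \<lambda>s. exp (k * s)) \<in> dom_Astar d"
proof -
  have "exp (k * s) = exp (k * (-d)) + (LINT r|lebesgue_on {-d..s}. k * exp (k * r))" if "s \<in> {-d..0}" for s
  proof -
    have "(LINT r|lebesgue_on {-d..s}. k * exp (k * r)) = exp (k * s) - exp (k * (-d))"
      using that by (intro LINT_FTC) (auto intro!: derivative_eq_intros continuous_intros)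
    then show ?thesis by simp
  qed
  then have "(\<lambda>s. exp (k * s)) \<in> W12 d"
    unfolding W12_def by (auto intro!: bexI[of _ "\<lambda>r. k * exp (k * r)"] continuous_L2_hist continuous_intros)
  then show ?thesis
    by (auto simp: dom_Astar_def X_space_def intro!: continuous_L2_hist continuous_intros)
qed

lemma Astar_exp: "Astar (1, \<lambda>s. exp (k * s)) = (0, \<lambda>s. k * exp (k * s))"
proof -
  have "((\<lambda>s. exp (k * s)) has_real_derivative k * exp (k * s)) (at s)" for s :: real
    by (auto intro!: derivative_eq_intros)
  then show ?thesis by (auto simp: Astar_def intro!: DERIV_imp_deriv)
qed

lemma innerX_exp: "innerX d x (1, \<lambda>s. exp (k * s)) = Gam d k x"
  by (simp add: innerX_def Gam_def mult.commute)

text \<open>Up to its vanishing first component, \<open>Astar\<close> multiplies an exponential by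
  \<open>k\<close>; the missing component is the source of \<open>- fst x\<close>. Only
  \<open>Gam d k\<close> and \<open>y\<^sup>0\<close> remain, which makes the tested equation
  scalar.\<close>

lemma opA_exp: "opA d x (1, \<lambda>s. exp (k * s)) = k * (Gam d k x - fst x)"
proof -
  have "(LINT s|lebesgue_on {-d..0}. snd x s * (k * exp (k * s)))
      = (LINT s|lebesgue_on {-d..0}. k * (exp (k * s) * snd x s))"
    by (simp add: algebra_simps)
  then show ?thesis by (simp add: opA_def Astar_exp innerX_def Gam_def)
qed

text \<open>Continuity is kept apart from the equation because the closed-loop control is itself a
  function of \<open>y\<close>: its membership in \<open>L2loc\<close> has to come from continuity
  of \<open>y\<close> before the locale \<open>delay_solution\<close> applies.\<close>

locale state_path =
  fixes d :: real and y :: "real \<Rightarrow> state"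
  assumes d_pos: "d > 0" and cont: "contX d y"
begin

lemma in_X: "t \<ge> 0 \<Longrightarrow> y t \<in> X_space d"
  using cont by (auto simp: contX_def)

lemma snd_integrable: "t \<ge> 0 \<Longrightarrow> integrable (lebesgue_on {-d..0}) (snd (y t))"
  using in_X[of t] by (auto simp: X_space_def intro: L2_hist_integrable)

lemma dist_tendsto: "t \<ge> 0 \<Longrightarrow> ((\<lambda>s. distX d (y s) (y t)) \<longlongrightarrow> 0) (at t within {0..})"
  using cont by (auto simp: contX_def)

lemma continuous_fst: "continuous_on {0..} (\<lambda>t. fst (y t))"
  unfolding continuous_on_def
proof
  fix t :: real assume "t \<in> {0..}"
  then have "((\<lambda>s. fst (y s) - fst (y t)) \<longlongrightarrow> 0) (at t within {0..})"
    by (intro Lim_null_comparison[OF _ dist_tendsto]) (auto simp: fst_diff_le_distX)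
  then show "((\<lambda>s. fst (y s)) \<longlongrightarrow> fst (y t)) (at t within {0..})" by (simp add: LIM_zero_iff)
qed

lemma continuous_pairing:
  assumes g: "continuous_on {-d..0} g"
  shows "continuous_on {0..} (\<lambda>t. LINT s|lebesgue_on {-d..0}. g s * snd (y t) s)"
  unfolding continuous_on_def
proof
  fix t :: real assume t: "t \<in> {0..}"
  obtain M where M: "\<And>s. s \<in> {-d..0} \<Longrightarrow> \<bar>g s\<bar> \<le> M"
    using compact_imp_bounded[OF compact_continuous_image[OF g compact_Icc]]
    unfolding bounded_iff by (metis image_eqI real_norm_def)
  have "M \<ge> 0" using M[of 0] d_pos by simp
  let ?P = "\<lambda>t. LINT s|lebesgue_on {-d..0}. g s * snd (y t) s"
  have lim: "((\<lambda>s. M * (sqrt d * distX d (y s) (y t))) \<longlongrightarrow> 0) (at t within {0..})"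
    using dist_tendsto[of t] t by (intro tendsto_mult_right_zero) auto
  have "((\<lambda>s. ?P s - ?P t) \<longlongrightarrow> 0) (at t within {0..})"
    by (rule Lim_null_comparison[OF _ lim])
      (use t M \<open>M \<ge> 0\<close> in \<open>auto simp: eventually_at_filter real_norm_def
        intro!: always_eventually pairing_diff_le_distX[OF d_pos] in_X g\<close>)
  then show "(?P \<longlongrightarrow> ?P t) (at t within {0..})" by (simp add: LIM_zero_iff)
qed

lemma continuous_Gam: "continuous_on {0..} (\<lambda>t. Gam d k (y t))"
proof -
  have "continuous_on {0..} (\<lambda>t. LINT s|lebesgue_on {-d..0}. exp (k * s) * snd (y t) s)"
    by (intro continuous_pairing continuous_intros)
  then show ?thesis unfolding Gam_def by (rule continuous_on_add[OF continuous_fst])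
qed

lemma continuous_drift: "continuous_on {0..} (\<lambda>t. k * (Gam d k (y t) - fst (y t)))"
  by (rule continuous_on_mult_left[OF continuous_on_diff[OF continuous_Gam continuous_fst]])

end

locale delay_solution = state_path d y for d At :: real and x :: state and u and y +
  assumes u_L2loc: "u \<in> L2loc" and solves: "solves d At x u y"
begin

lemma u_integrable:
  assumes "0 \<le> a" shows "integrable (lebesgue_on {a..b}) u"
proof -
  have "integrable (lebesgue_on {0..max 0 b}) u"
    using u_L2loc by (intro square_integrable_imp_integrable[of u 0 "max 0 b"])
      (auto simp: L2loc_def intro: measurable_restrict_mono[of _ _ "{0..}"])
  then show ?thesis by (rule integrable_subinterval) (use assms in auto)
qed

text \<open>The factor \<open>exp (- (k * d))\<close> is the value of the test function
  \<open>exp (k * s)\<close> at \<open>-d\<close>. The interval avoids 0 because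
  \<open>has_deriv_dual\<close> speaks about positive times only.\<close>

lemma Gam_increment_pos:
  assumes "0 < a" and "a \<le> b"
  shows "Gam d k (y b) - Gam d k (y a)
    = (LINT t|lebesgue_on {a..b}. k * (Gam d k (y t) - fst (y t)) + At * exp (- (k * d)) * u t)"
proof -
  let ?\<psi> = "(1, \<lambda>s. exp (k * s)) :: state"
  obtain h where h: "h \<in> L2loc_dual d" "has_deriv_dual d y h"
    and ae: "AE t in lebesgue_on {0..}. \<forall>\<psi>\<in>dom_Astar d.
           h t \<psi> = opA d (y t) \<psi> + u t * At * delta_md d \<psi>"
    using solves by (auto simp: solves_def)
  note dom = exp_in_dom_Astar[OF d_pos, of k]
  have "Gam d k (y b) - Gam d k (y a) = (LINT t|lebesgue_on {a..b}. h t ?\<psi>)"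
    using h(2) dom assms by (auto simp: has_deriv_dual_def innerX_exp[symmetric])
  also have "\<dots> = (LINT t|lebesgue_on {a..b}. k * (Gam d k (y t) - fst (y t)) + At * exp (- (k * d)) * u t)"
  proof (rule integral_cong_AE)
    show "(\<lambda>t. h t ?\<psi>) \<in> borel_measurable (lebesgue_on {a..b})"
      by (rule measurable_restrict_mono[of _ _ "{0<..}"])
        (use h(1) dom assms in \<open>auto simp: L2loc_dual_def\<close>)
    have "continuous_on {a..b} (\<lambda>t. k * (Gam d k (y t) - fst (y t)))"
      by (rule continuous_on_subset[OF continuous_drift]) (use assms in auto)
    then have "(\<lambda>t. k * (Gam d k (y t) - fst (y t))) \<in> borel_measurable (lebesgue_on {a..b})"
      by (rule continuous_imp_measurable_on_sets_lebesgue) simp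
    moreover have "(\<lambda>t. At * exp (- (k * d)) * u t) \<in> borel_measurable (lebesgue_on {a..b})"
      using u_integrable[of a b] assms by simp
    ultimately show "(\<lambda>t. k * (Gam d k (y t) - fst (y t)) + At * exp (- (k * d)) * u t)
        \<in> borel_measurable (lebesgue_on {a..b})"
      by (rule borel_measurable_add)
    have "AE t in lebesgue_on {0..}. h t ?\<psi> = k * (Gam d k (y t) - fst (y t)) + At * exp (- (k * d)) * u t"
      using ae by eventually_elim (use dom in \<open>auto simp: opA_exp delta_md_def\<close>)
    then show "AE t in lebesgue_on {a..b}. h t ?\<psi> = k * (Gam d k (y t) - fst (y t)) + At * exp (- (k * d)) * u t"
      using assms by (auto simp: AE_restrict_space_iff)
  qed
  finally show ?thesis .
qed

lemma Gam_derivative_integrable: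
  assumes "0 \<le> a"
  shows "integrable (lebesgue_on {a..b}) (\<lambda>t. k * (Gam d k (y t) - fst (y t)) + At * exp (- (k * d)) * u t)"
proof (rule Bochner_Integration.integrable_add)
  show "integrable (lebesgue_on {a..b}) (\<lambda>t. k * (Gam d k (y t) - fst (y t)))"
    by (rule continuous_imp_integrable_real, rule continuous_on_subset[OF continuous_drift])
      (use assms in auto)
  show "integrable (lebesgue_on {a..b}) (\<lambda>t. At * exp (- (k * d)) * u t)"
    using u_integrable[OF assms] by simp
qed

text \<open>By the increments on positive intervals, the difference \<open>F\<close> of
  \<open>Gam d k (y t)\<close> and the running integral is constant on \<open>{0<..b}\<close>;
  continuity at 0 carries this to the initial state.\<close>

lemma Gam_increment:
  assumes "0 \<le> a" and "a \<le> b"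
  shows "Gam d k (y b) - Gam d k (y a)
    = (LINT t|lebesgue_on {a..b}. k * (Gam d k (y t) - fst (y t)) + At * exp (- (k * d)) * u t)"
proof (cases "0 < a \<or> a = b")
  case True
  then show ?thesis
    using Gam_increment_pos[of a b k] assms LINT_FTC[of a a "\<lambda>_. 0" "\<lambda>_. 0"]
    by (auto simp: integral_eq_zero_null_sets)
next
  case False
  then have "a = 0" "0 < b" using assms by auto
  let ?g = "\<lambda>t. k * (Gam d k (y t) - fst (y t)) + At * exp (- (k * d)) * u t"
  define F where "F t = Gam d k (y t) - (LINT t|lebesgue_on {0..t}. ?g t)" for t
  have "continuous_on {0..b} F"
    unfolding F_def by (intro continuous_on_diff continuous_on_subset[OF continuous_Gam]
      indefinite_integral_continuous_real Gam_derivative_integrable) auto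
  then have "(F \<longlongrightarrow> F 0) (at 0 within {0..b})"
    using \<open>0 < b\<close> by (simp add: continuous_on)
  moreover have "F t = F b" if "t \<in> {0..b}" "t \<noteq> 0" for t
    using Equivalence_Measurable_On_Borel.integral_combine[of 0 b ?g t] Gam_increment_pos[of t b k]
      Gam_derivative_integrable[of 0 b k] that by (simp add: F_def)
  then have "(F \<longlongrightarrow> F b) (at 0 within {0..b})"
    by (intro tendsto_eventually, unfold eventually_at_filter, intro always_eventually) blast
  moreover have "at 0 within {0..b} \<noteq> bot"
    using \<open>0 < b\<close> by (simp add: trivial_limit_within islimpt_Icc)
  ultimately have "F 0 = F b" by (metis tendsto_unique)
  then show ?thesis by (simp add: F_def \<open>a = 0\<close> integral_eq_zero_null_sets)
qed

text \<open>The integrating factor \<open>exp (- (k * t))\<close> removes the term with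
  \<open>Gam\<close> from the right-hand side. For \<open>k = \<xi>\<close> the two remaining
  coefficients coincide and consumption \<open>y\<^sup>0 - u\<close> appears.\<close>

lemma weighted_Gam_increment:
  assumes "0 \<le> a" and "a \<le> b"
  shows "exp (- (k * b)) * Gam d k (y b) - exp (- (k * a)) * Gam d k (y a)
    = (LINT t|lebesgue_on {a..b}. exp (- (k * t)) * (At * exp (- (k * d)) * u t - k * fst (y t)))"
proof -
  have "exp (- (k * b)) * Gam d k (y b) - exp (- (k * a)) * Gam d k (y a)
    = (LINT t|lebesgue_on {a..b}. - k * exp (- (k * t)) * Gam d k (y t)
        + exp (- (k * t)) * (k * (Gam d k (y t) - fst (y t)) + At * exp (- (k * d)) * u t))"
  proof (rule integral_product_rule[OF \<open>a \<le> b\<close> Gam_derivative_integrable[OF \<open>0 \<le> a\<close>] Gam_increment])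
    show "continuous_on {a..b} (\<lambda>t. - k * exp (- (k * t)))" by (intro continuous_intros)
    show "((\<lambda>t. exp (- (k * t))) has_real_derivative - k * exp (- (k * t))) (at t within {a..b})" for t
      by (auto intro!: derivative_eq_intros)
  qed (use assms in auto)
  also have "\<dots> = (LINT t|lebesgue_on {a..b}. exp (- (k * t)) * (At * exp (- (k * d)) * u t - k * fst (y t)))"
    by (simp add: algebra_simps)
  finally show ?thesis .
qed

end

lemma delay_solutionI:
  assumes "d > 0" and "u \<in> L2loc" and "solves d At x u y"
  shows "delay_solution d At x u y"
  using assms by unfold_locales (auto simp: solves_def)

section \<open>Transported test functions\<close>

text \<open>Apply Weierstrass to \<open>z \<mapsto> q (ln z) / z\<close>: a polynomial in \<open>z = exp s\<close> without constant term has
  an exponential sum as antiderivative.\<close>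

lemma C1_exp_sum_approximation:
  fixes P q :: "real \<Rightarrow> real"
  assumes "L < 0" and "\<epsilon> > 0" and q: "continuous_on {L..0} q"
    and P: "\<And>s. s \<in> {L..0} \<Longrightarrow> (P has_real_derivative q s) (at s within {L..0})"
  obtains n :: nat and c :: "nat \<Rightarrow> real" where
    "\<And>s. s \<in> {L..0} \<Longrightarrow> \<bar>P s - (\<Sum>i\<le>n. c i * exp (real i * s))\<bar> \<le> \<epsilon>"
    "\<And>s. s \<in> {L..0} \<Longrightarrow> \<bar>q s - (\<Sum>i\<le>n. c i * (real i * exp (real i * s)))\<bar> \<le> \<epsilon>"
proof -
  \<comment> \<open>An error \<open>\<eta>\<close> in the derivative grows to at most
    \<open>\<eta> * - L\<close> when integrated over \<open>{L..0}\<close>; dividing by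
    \<open>1 - L\<close> keeps both errors below \<epsilon>.\<close>
  define \<eta> where "\<eta> = \<epsilon> / (1 - L)"
  have \<eta>: "0 < \<eta>" "\<eta> \<le> \<epsilon>" "\<eta> * - L \<le> \<epsilon>"
    using \<open>L < 0\<close> \<open>\<epsilon> > 0\<close> by (auto simp: \<eta>_def field_simps mult_le_0_iff)
  have "continuous_on {exp L..1} (\<lambda>z. q (ln z) / z)"
  proof (intro continuous_intros continuous_on_compose2[OF q])
    show "ln ` {exp L..1} \<subseteq> {L..0}"
    proof clarsimp
      fix z assume z: "exp L \<le> z" "z \<le> (1::real)"
      then have "0 < z" using exp_gt_zero[of L] by linarith
      then show "L \<le> ln z \<and> ln z \<le> 0" using z by (simp add: ln_ge_iff)
    qed
    have "z \<noteq> 0" if "z \<in> {exp L..1}" for z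
      using exp_gt_zero[of L] that by (metis atLeastAtMost_iff linorder_not_le)
    then show "\<forall>z\<in>{exp L..1}. z \<noteq> 0" "\<forall>z\<in>{exp L..1}. z \<noteq> 0" by auto
  qed
  from Stone_Weierstrass_real_polynomial_function[OF compact_Icc this \<eta>(1)]
  obtain g where g: "real_polynomial_function g" "\<And>z. z \<in> {exp L..1} \<Longrightarrow> \<bar>q (ln z) / z - g z\<bar> < \<eta>"
    by metis
  obtain b n where b: "g = (\<lambda>z. \<Sum>i\<le>n. b i * z ^ i)"
    using g(1) real_polynomial_function_iff_sum by auto
  \<comment> \<open>Antidifferentiating \<open>exp (real (Suc j) * s)\<close> divides by
    \<open>Suc j\<close>; the free constant \<open>c 0\<close> is fixed by agreement with
    \<open>P\<close> at \<open>L\<close>, where the mean value estimate starts.\<close>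
  define c where "c i = (case i of 0 \<Rightarrow> P L - (\<Sum>i\<le>n. b i / real (Suc i) * exp (real (Suc i) * L))
    | Suc j \<Rightarrow> b j / real (Suc j))" for i
  define p where "p s = (\<Sum>i\<le>Suc n. c i * exp (real i * s))" for s
  define p' where "p' s = (\<Sum>i\<le>Suc n. c i * (real i * exp (real i * s)))" for s
  have p'_eq: "p' s = exp s * g (exp s)" for s
  proof -
    have "p' s = (\<Sum>i\<le>n. b i * exp (real (Suc i) * s))"
      unfolding p'_def by (subst sum.atMost_Suc_shift) (simp add: c_def del: of_nat_Suc)
    also have "\<dots> = (\<Sum>i\<le>n. exp s * (b i * exp s ^ i))"
      by (intro sum.cong refl) (metis exp_of_nat_mult mult.left_commute power_Suc)
    finally show ?thesis by (simp add: b sum_distrib_left)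
  qed
  have dev': "\<bar>q s - p' s\<bar> \<le> \<eta>" if s: "s \<in> {L..0}" for s
  proof -
    have "\<bar>q (ln (exp s)) / exp s - g (exp s)\<bar> < \<eta>" using g(2)[of "exp s"] s by simp
    moreover have "q s - p' s = exp s * (q (ln (exp s)) / exp s - g (exp s))"
      by (simp add: p'_eq algebra_simps)
    ultimately have "\<bar>q s - p' s\<bar> \<le> exp s * \<eta>" by (simp add: abs_mult)
    also have "\<dots> \<le> \<eta>" using s \<eta>(1) by simp
    finally show ?thesis .
  qed
  have dev: "\<bar>P s - p s\<bar> \<le> \<eta> * - L" if s: "s \<in> {L..0}" for s
  proof -
    have "p L = P L"
      unfolding p_def by (subst sum.atMost_Suc_shift) (simp add: c_def)
    moreover have "norm ((P s - p s) - (P L - p L)) \<le> \<eta> * norm (s - L)"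
    proof (rule field_differentiable_bound[of "{L..0}"])
      show "((\<lambda>s. P s - p s) has_real_derivative q z - p' z) (at z within {L..0})" if "z \<in> {L..0}" for z
        unfolding p_def p'_def using P[OF that] by (auto intro!: derivative_eq_intros sum.cong)
      show "norm (q z - p' z) \<le> \<eta>" if "z \<in> {L..0}" for z
        using dev'[OF that] by simp
    qed (use s in auto)
    ultimately have "\<bar>P s - p s\<bar> \<le> \<eta> * (s - L)" using s by simp
    also have "\<dots> \<le> \<eta> * - L" using s \<eta>(1) by (intro mult_left_mono) auto
    finally show ?thesis .
  qed
  show ?thesis
    by (rule that[OF order_trans[OF dev[unfolded p_def] \<eta>(3)] order_trans[OF dev'[unfolded p'_def] \<eta>(2)]])
qed

text \<open>Exponential sums are dense among C1 functions in the C1 norm, and \<open>E\<close> is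
  bounded in that norm. The derivative is a separate argument of \<open>E\<close> so that linearity
  and boundedness need only ask for continuity of both arguments.\<close>

lemma C1_functional_eq_0:
  fixes E :: "(real \<Rightarrow> real) \<Rightarrow> (real \<Rightarrow> real) \<Rightarrow> real"
  assumes "L < 0"
    and lin: "\<And>p q p' q' c. continuous_on {L..0} p \<Longrightarrow> continuous_on {L..0} q \<Longrightarrow>
      continuous_on {L..0} p' \<Longrightarrow> continuous_on {L..0} q' \<Longrightarrow>
      E (\<lambda>s. p s + c * p' s) (\<lambda>s. q s + c * q' s) = E p q + c * E p' q'"
    and bound: "\<And>p q e. continuous_on {L..0} p \<Longrightarrow> continuous_on {L..0} q \<Longrightarrow>
      (\<And>s. s \<in> {L..0} \<Longrightarrow> \<bar>p s\<bar> \<le> e \<and> \<bar>q s\<bar> \<le> e) \<Longrightarrow> \<bar>E p q\<bar> \<le> C * e"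
    and zero: "\<And>k. E (\<lambda>s. exp (k * s)) (\<lambda>s. k * exp (k * s)) = 0"
    and q: "continuous_on {L..0} q"
    and P: "\<And>s. s \<in> {L..0} \<Longrightarrow> (P has_real_derivative q s) (at s within {L..0})"
  shows "E P q = 0"
proof -
  have sum0: "E (\<lambda>s. \<Sum>i\<le>n. c i * exp (real i * s)) (\<lambda>s. \<Sum>i\<le>n. c i * (real i * exp (real i * s))) = 0"
    for n :: nat and c :: "nat \<Rightarrow> real"
  proof (induction n)
    case 0
    \<comment> \<open>\<open>lin\<close> only splits off a multiple, so the empty sum is settled by
      \<open>bound\<close> with \<open>e = 0\<close>.\<close>
    have "E (\<lambda>s. 0 + c 0 * exp (0 * s)) (\<lambda>s. 0 + c 0 * (0 * exp (0 * s)))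
      = E (\<lambda>s. 0) (\<lambda>s. 0) + c 0 * E (\<lambda>s. exp (0 * s)) (\<lambda>s. 0 * exp (0 * s))"
      by (rule lin) (auto intro!: continuous_intros)
    then show ?case using bound[of "\<lambda>_. 0" "\<lambda>_. 0" 0] zero[of 0] by simp
  next
    case (Suc n)
    then show ?case
      by (simp, subst lin) (auto intro!: continuous_intros simp: zero[of "1 + real n"] simp del: of_nat_Suc)
  qed
  have contP: "continuous_on {L..0} P" using P by (meson DERIV_continuous_on)
  have small: "\<bar>E P q\<bar> \<le> C * \<epsilon>" if eps: "\<epsilon> > 0" for \<epsilon>
  proof -
    obtain n c where nc: "\<And>s. s \<in> {L..0} \<Longrightarrow> \<bar>P s - (\<Sum>i\<le>n. c i * exp (real i * s))\<bar> \<le> \<epsilon>"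
      "\<And>s. s \<in> {L..0} \<Longrightarrow> \<bar>q s - (\<Sum>i\<le>n. c i * (real i * exp (real i * s)))\<bar> \<le> \<epsilon>"
      by (rule C1_exp_sum_approximation[OF \<open>L < 0\<close> eps q]) (rule P, assumption, rule that)
    let ?p = "\<lambda>s. \<Sum>i\<le>n. c i * exp (real i * s)" and ?p' = "\<lambda>s. \<Sum>i\<le>n. c i * (real i * exp (real i * s))"
    have "E (\<lambda>s. P s + (- 1) * ?p s) (\<lambda>s. q s + (- 1) * ?p' s) = E P q + (- 1) * E ?p ?p'"
      by (rule lin) (intro contP q continuous_intros)+
    moreover have "\<bar>E (\<lambda>s. P s + (- 1) * ?p s) (\<lambda>s. q s + (- 1) * ?p' s)\<bar> \<le> C * \<epsilon>"
      using nc by (intro bound continuous_on_add contP q continuous_intros) auto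
    ultimately show ?thesis by (simp add: sum0)
  qed
  have "((\<lambda>\<epsilon>. C * \<epsilon>) \<longlongrightarrow> C * 0) (at_right 0)" by (intro tendsto_intros)
  then have "\<bar>E P q\<bar> \<le> C * 0"
    by (rule tendsto_lowerbound)
      (rule eventually_mono[OF eventually_at_right_less small], assumption, simp)
  then show ?thesis by simp
qed

lemma integral_mult_linear_combination:
  fixes f g h :: "real \<Rightarrow> real"
  assumes "continuous_on {a..b} g" "continuous_on {a..b} h" "integrable (lebesgue_on {a..b}) f"
  shows "(LINT x|lebesgue_on {a..b}. (g x + c * h x) * f x)
    = (LINT x|lebesgue_on {a..b}. g x * f x) + c * (LINT x|lebesgue_on {a..b}. h x * f x)"
proof -
  have "(LINT x|lebesgue_on {a..b}. (g x + c * h x) * f x)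
      = (LINT x|lebesgue_on {a..b}. g x * f x + c * (h x * f x))"
    by (simp add: algebra_simps)
  then show ?thesis using assms by (simp add: integrable_continuous_mult)
qed

text \<open>Testing the equation with the transported function \<open>s \<mapsto> P (s - (t - a))\<close> at time \<open>t\<close>; for
  exponential \<open>P\<close> transport is multiplication by a scalar.\<close>

lemma (in delay_solution) transport_identity:
  assumes "0 \<le> a" and "0 \<le> T" and q: "continuous_on {-(T+d)..0} q"
    and P: "\<And>s. s \<in> {-(T+d)..0} \<Longrightarrow> (P has_real_derivative q s) (at s within {-(T+d)..0})"
  shows "P (-T) * fst (y (a + T)) + (LINT s|lebesgue_on {-d..0}. P (s - T) * snd (y (a + T)) s)
    = P 0 * fst (y a) + (LINT s|lebesgue_on {-d..0}. P s * snd (y a) s)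
      + At * (LINT w|lebesgue_on {a..a+T}. P (a - d - w) * u w)
      - (LINT w|lebesgue_on {a..a+T}. q (a - w) * fst (y w))"
proof -
  \<comment> \<open>The arguments \<open>s - T\<close>, \<open>s\<close>, \<open>a - d - w\<close>
    and \<open>a - w\<close> at which \<open>P\<close> and \<open>q\<close> are evaluated together
    fill exactly the interval from \<open>?L\<close> to 0.\<close>
  let ?L = "- (T + d)"
  define E where "E p q = p (-T) * fst (y (a + T)) + (LINT s|lebesgue_on {-d..0}. p (s - T) * snd (y (a + T)) s)
    - p 0 * fst (y a) - (LINT s|lebesgue_on {-d..0}. p s * snd (y a) s)
    - At * (LINT w|lebesgue_on {a..a+T}. p (a - d - w) * u w)
    + (LINT w|lebesgue_on {a..a+T}. q (a - w) * fst (y w))" for p q :: "real \<Rightarrow> real"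
  define C where "C = \<bar>fst (y (a + T))\<bar> + (LINT s|lebesgue_on {-d..0}. \<bar>snd (y (a + T)) s\<bar>)
    + \<bar>fst (y a)\<bar> + (LINT s|lebesgue_on {-d..0}. \<bar>snd (y a) s\<bar>)
    + \<bar>At\<bar> * (LINT w|lebesgue_on {a..a+T}. \<bar>u w\<bar>) + (LINT w|lebesgue_on {a..a+T}. \<bar>fst (y w)\<bar>)"
  have cont: "continuous_on {-d..0} (\<lambda>s. p (s - T))" "continuous_on {-d..0} p"
    "continuous_on {a..a+T} (\<lambda>w. p (a - d - w))" "continuous_on {a..a+T} (\<lambda>w. p (a - w))"
    if "continuous_on {?L..0} p" for p :: "real \<Rightarrow> real"
    using \<open>0 \<le> T\<close> d_pos
    by (auto intro!: continuous_on_compose2[OF that] continuous_intros continuous_on_subset[OF that])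
  have int: "integrable (lebesgue_on {-d..0}) (snd (y (a + T)))" "integrable (lebesgue_on {-d..0}) (snd (y a))"
    "integrable (lebesgue_on {a..a+T}) u" "integrable (lebesgue_on {a..a+T}) (\<lambda>w. fst (y w))"
  proof -
    show "integrable (lebesgue_on {a..a+T}) (\<lambda>w. fst (y w))"
      by (rule continuous_imp_integrable_real, rule continuous_on_subset[OF continuous_fst])
        (use assms(1) in auto)
  qed (use assms(1,2) in \<open>auto intro: snd_integrable u_integrable\<close>)
  have "E P q = 0"
  proof (rule C1_functional_eq_0[of ?L E C])
    show "?L < 0" using \<open>0 \<le> T\<close> d_pos by simp
  next
    fix p q p' q' :: "real \<Rightarrow> real" and c :: real
    assume c: "continuous_on {?L..0} p" "continuous_on {?L..0} q"
      "continuous_on {?L..0} p'" "continuous_on {?L..0} q'"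
    show "E (\<lambda>s. p s + c * p' s) (\<lambda>s. q s + c * q' s) = E p q + c * E p' q'"
      unfolding E_def
      by (simp add: integral_mult_linear_combination[OF cont(1)[OF c(1)] cont(1)[OF c(3)] int(1)]
          integral_mult_linear_combination[OF cont(2)[OF c(1)] cont(2)[OF c(3)] int(2)]
          integral_mult_linear_combination[OF cont(3)[OF c(1)] cont(3)[OF c(3)] int(3)]
          integral_mult_linear_combination[OF cont(4)[OF c(2)] cont(4)[OF c(4)] int(4)])
        (simp add: algebra_simps)
  next
    fix p q :: "real \<Rightarrow> real" and e :: real
    assume c: "continuous_on {?L..0} p" "continuous_on {?L..0} q"
      and e: "\<And>s. s \<in> {?L..0} \<Longrightarrow> \<bar>p s\<bar> \<le> e \<and> \<bar>q s\<bar> \<le> e"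
    have "\<bar>LINT s|lebesgue_on {-d..0}. p (s - T) * snd (y (a + T)) s\<bar>
        \<le> e * (LINT s|lebesgue_on {-d..0}. \<bar>snd (y (a + T)) s\<bar>)"
      using e \<open>0 \<le> T\<close> d_pos by (intro integral_continuous_mult_bound cont(1)[OF c(1)] int) auto
    moreover have "\<bar>LINT s|lebesgue_on {-d..0}. p s * snd (y a) s\<bar>
        \<le> e * (LINT s|lebesgue_on {-d..0}. \<bar>snd (y a) s\<bar>)"
      using e \<open>0 \<le> T\<close> d_pos by (intro integral_continuous_mult_bound cont(2)[OF c(1)] int) auto
    moreover have "\<bar>LINT w|lebesgue_on {a..a+T}. p (a - d - w) * u w\<bar>
        \<le> e * (LINT w|lebesgue_on {a..a+T}. \<bar>u w\<bar>)"
      using e \<open>0 \<le> T\<close> d_pos by (intro integral_continuous_mult_bound cont(3)[OF c(1)] int) auto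
    then have "\<bar>At * (LINT w|lebesgue_on {a..a+T}. p (a - d - w) * u w)\<bar>
        \<le> e * (\<bar>At\<bar> * (LINT w|lebesgue_on {a..a+T}. \<bar>u w\<bar>))"
      by (simp add: abs_mult) (metis abs_ge_zero mult.left_commute mult_left_mono)
    moreover have "\<bar>LINT w|lebesgue_on {a..a+T}. q (a - w) * fst (y w)\<bar>
        \<le> e * (LINT w|lebesgue_on {a..a+T}. \<bar>fst (y w)\<bar>)"
      using e \<open>0 \<le> T\<close> d_pos by (intro integral_continuous_mult_bound cont(4)[OF c(2)] int) auto
    moreover have "\<bar>p (-T) * fst (y (a + T))\<bar> \<le> e * \<bar>fst (y (a + T))\<bar>" "\<bar>p 0 * fst (y a)\<bar> \<le> e * \<bar>fst (y a)\<bar>"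
      using e[of "-T"] e[of 0] \<open>0 \<le> T\<close> d_pos by (auto simp: abs_mult mult_right_mono)
    moreover have "C * e = e * \<bar>fst (y (a + T))\<bar> + e * (LINT s|lebesgue_on {-d..0}. \<bar>snd (y (a + T)) s\<bar>)
      + e * \<bar>fst (y a)\<bar> + e * (LINT s|lebesgue_on {-d..0}. \<bar>snd (y a) s\<bar>)
      + e * (\<bar>At\<bar> * (LINT w|lebesgue_on {a..a+T}. \<bar>u w\<bar>)) + e * (LINT w|lebesgue_on {a..a+T}. \<bar>fst (y w)\<bar>)"
      by (simp add: C_def algebra_simps)
    ultimately show "\<bar>E p q\<bar> \<le> C * e" unfolding E_def abs_le_iff by linarith
  next
    fix k :: real
    have s1: "(LINT s|lebesgue_on {-d..0}. exp (k * (s - T)) * snd (y (a + T)) s)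
        = exp (- (k * T)) * (LINT s|lebesgue_on {-d..0}. exp (k * s) * snd (y (a + T)) s)"
      by (subst integral_mult_right_zero[symmetric]) (simp add: exp_diff exp_minus field_simps)
    have "exp (- (k * (a + T))) * Gam d k (y (a + T)) - exp (- (k * a)) * Gam d k (y a)
      = (LINT t|lebesgue_on {a..a+T}. exp (- (k * t)) * (At * exp (- (k * d)) * u t - k * fst (y t)))"
      using weighted_Gam_increment[of a "a + T" k] assms(1,2) by simp
    \<comment> \<open>The integrating factor is normalised at time 0, whereas transport starts at
      time \<open>a\<close>; \<open>exp (k * a)\<close> converts one into the other.\<close>
    then have "exp (k * a) * (exp (- (k * (a + T))) * Gam d k (y (a + T)) - exp (- (k * a)) * Gam d k (y a))
      = exp (k * a) * (LINT t|lebesgue_on {a..a+T}. exp (- (k * t)) * (At * exp (- (k * d)) * u t - k * fst (y t)))"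
      by simp
    also have "exp (k * a) * (exp (- (k * (a + T))) * Gam d k (y (a + T)) - exp (- (k * a)) * Gam d k (y a))
      = exp (- (k * T)) * Gam d k (y (a + T)) - Gam d k (y a)"
      by (simp add: right_diff_distrib mult.assoc[symmetric] exp_add[symmetric] algebra_simps)
    also have "exp (k * a) * (LINT t|lebesgue_on {a..a+T}. exp (- (k * t)) * (At * exp (- (k * d)) * u t - k * fst (y t)))
      = (LINT t|lebesgue_on {a..a+T}. At * (exp (k * (a - d - t)) * u t) - (k * exp (k * (a - t))) * fst (y t))"
      by (subst integral_mult_right_zero[symmetric])
        (simp add: algebra_simps exp_add exp_diff exp_minus field_simps)
    also have "\<dots> = At * (LINT t|lebesgue_on {a..a+T}. exp (k * (a - d - t)) * u t)
        - (LINT t|lebesgue_on {a..a+T}. (k * exp (k * (a - t))) * fst (y t))"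
      by (subst Bochner_Integration.integral_diff)
        (auto intro!: integrable_mult_right integrable_continuous_mult int continuous_intros)
    finally show "E (\<lambda>s. exp (k * s)) (\<lambda>s. k * exp (k * s)) = 0"
      unfolding E_def s1 Gam_def by (simp add: algebra_simps)
  qed (use q P in auto)
  then show ?thesis unfolding E_def by simp
qed

text \<open>The test function vanishes on \<open>[-(T + d), -T]\<close>, which removes the states at time \<open>T\<close>, and its
  derivative is the reflected difference times \<open>T + s\<close>.\<close>

lemma delay_solution_fst_unique:
  assumes "delay_solution d At x u y" and "delay_solution d At x u z" and "0 \<le> t"
  shows "fst (y t) = fst (z t)"
proof -
  interpret Y: delay_solution d At x u y by fact
  interpret Z: delay_solution d At x u z by fact
  \<comment> \<open>Taken beyond \<open>t\<close> so that the weight \<open>T - w\<close>, which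
    vanishes at \<open>T\<close>, is positive at \<open>w = t\<close>.\<close>
  define T where "T = t + 1"
  have "0 < T" "t < T" using \<open>0 \<le> t\<close> by (auto simp: T_def)
  define w0 where "w0 r = fst (y r) - fst (z r)" for r
  have cw: "continuous_on {0..} w0"
    unfolding w0_def by (rule continuous_on_diff[OF Y.continuous_fst Z.continuous_fst])
  \<comment> \<open>The first clamp keeps the argument of \<open>w0\<close> in \<open>{0..}\<close>,
    where it is continuous; the second makes \<open>q\<close>, and with it \<open>P\<close>, vanish
    up to \<open>-T\<close>.\<close>
  define q where "q s = w0 (max 0 (- s)) * max 0 (T + s)" for s
  let ?L = "- (T + d)"
  have q: "continuous_on A q" for A
  proof -
    have "continuous_on A (\<lambda>s. w0 (max 0 (- s)))"
      by (rule continuous_on_compose2[OF cw]) (auto intro!: continuous_intros)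
    then show ?thesis unfolding q_def by (intro continuous_intros)
  qed
  define P where "P s = integral {?L..s} q" for s
  have P: "(P has_real_derivative q s) (at s within {?L..0})" if "s \<in> {?L..0}" for s
    unfolding P_def by (rule integral_has_real_derivative[OF q that])
  have P0: "P s = 0" if "s \<le> -T" for s
  proof -
    have "P s = integral {?L..s} (\<lambda>_. 0)"
      unfolding P_def by (rule Henstock_Kurzweil_Integration.integral_cong) (use that in \<open>auto simp: q_def\<close>)
    then show ?thesis by simp
  qed
  \<comment> \<open>The terms with the initial state and the control are the same for both
    solutions, so subtraction leaves the pairings of \<open>q\<close> with \<open>y\<^sup>0\<close>
    and \<open>z\<^sup>0\<close>, whose difference is the integral of
    \<open>(w0 w)\<^sup>2 * (T - w)\<close>.\<close>
  have id: "0 = P 0 * fst (v 0) + (LINT s|lebesgue_on {-d..0}. P s * snd (v 0) s)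
      + At * (LINT w|lebesgue_on {0..T}. P (- d - w) * u w) - (LINT w|lebesgue_on {0..T}. q (- w) * fst (v w))"
    if "delay_solution d At x u v" for v
  proof -
    have "(LINT s|lebesgue_on {-d..0}. P (s - T) * snd (v (0 + T)) s) = (LINT s|lebesgue_on {-d..0}. 0)"
      by (rule Bochner_Integration.integral_cong) (auto simp: P0)
    then show ?thesis
      using delay_solution.transport_identity[OF that, of 0 T q P] q P \<open>0 < T\<close> P0[of "-T"] by simp
  qed
  have contP: "continuous_on {-d..0} P"
    by (rule continuous_on_subset[OF DERIV_continuous_on[OF P]]) (use \<open>0 < T\<close> in auto)
  have eq: "eqX d (y 0) x" "eqX d (z 0) x"
    using Y.solves Z.solves by (auto simp: solves_def)
  have "(LINT s|lebesgue_on {-d..0}. P s * snd (y 0) s) = (LINT s|lebesgue_on {-d..0}. P s * snd (z 0) s)"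
  proof (rule integral_cong_AE)
    have "AE s in lebesgue_on {-d..0}. snd (y 0) s = snd x s" "AE s in lebesgue_on {-d..0}. snd (z 0) s = snd x s"
      using eq by (auto simp: eqX_def)
    then show "AE s in lebesgue_on {-d..0}. P s * snd (y 0) s = P s * snd (z 0) s"
      by eventually_elim simp
  qed (auto intro!: borel_measurable_integrable integrable_continuous_mult contP Y.snd_integrable Z.snd_integrable)
  then have "(LINT w|lebesgue_on {0..T}. q (- w) * fst (y w)) = (LINT w|lebesgue_on {0..T}. q (- w) * fst (z w))"
    using id[OF assms(1)] id[OF assms(2)] eq by (simp add: eqX_def)
  moreover have int: "integrable (lebesgue_on {0..T}) (\<lambda>w. q (- w) * fst (y w))"
    "integrable (lebesgue_on {0..T}) (\<lambda>w. q (- w) * fst (z w))"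
    by (intro integrable_continuous_mult continuous_on_compose2[OF q] continuous_imp_integrable_real
        continuous_on_subset[OF Y.continuous_fst] continuous_on_subset[OF Z.continuous_fst];
        auto intro!: continuous_intros)+
  ultimately have "(LINT w|lebesgue_on {0..T}. q (- w) * fst (y w) - q (- w) * fst (z w)) = 0"
    by simp
  also have "(LINT w|lebesgue_on {0..T}. q (- w) * fst (y w) - q (- w) * fst (z w))
      = (LINT w|lebesgue_on {0..T}. (w0 w)\<^sup>2 * (T - w))"
    by (rule Bochner_Integration.integral_cong) (auto simp: q_def w0_def power2_eq_square algebra_simps max_def)
  finally have "\<forall>w\<in>{0..T}. (w0 w)\<^sup>2 * (T - w) = 0"
    using \<open>0 < T\<close> by (subst (asm) integralL_eq_0_iff)
      (auto intro!: continuous_on_mult continuous_on_power continuous_on_subset[OF cw] continuous_on_diff)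
  then show ?thesis using \<open>0 \<le> t\<close> \<open>t < T\<close> by (auto simp: w0_def)
qed

text \<open>Provides a continuously differentiable cut-off below \<open>-d\<close>, which the
  positive part alone is not. At the kink the difference quotient is bounded by
  \<open>\<bar>h\<bar>\<close>.\<close>

lemma DERIV_max_0_power2:
  "((\<lambda>s. (max 0 (s + d))\<^sup>2) has_real_derivative 2 * max 0 (s + d)) (at s within A)" for s d :: real
proof -
  have "((\<lambda>s. (max 0 (s + d))\<^sup>2) has_real_derivative 2 * max 0 (s + d)) (at s)"
  proof (cases "s + d = 0")
    case True
    have "((\<lambda>h::real. (max 0 h)\<^sup>2 / h) \<longlongrightarrow> 0) (at 0)"
    proof (rule Lim_null_comparison)
      show "\<forall>\<^sub>F h in at 0. norm ((max 0 h)\<^sup>2 / h) \<le> \<bar>h\<bar>"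
        by (intro always_eventually allI) (auto simp: max_def power2_eq_square)
      show "((\<lambda>h::real. \<bar>h\<bar>) \<longlongrightarrow> 0) (at 0)" by (intro tendsto_rabs_zero tendsto_ident_at)
    qed
    moreover have "d = - s" using True by simp
    ultimately show ?thesis by (simp add: DERIV_def)
  next
    case False
    then consider "s + d < 0" | "s + d > 0" by linarith
    then show ?thesis
    proof cases
      case 1
      have "((\<lambda>s. 0) has_real_derivative 2 * max 0 (s + d)) (at s)" using 1 by simp
      moreover have "\<forall>\<^sub>F r in nhds s. 0 = (max 0 (r + d))\<^sup>2"
        using 1 by (intro eventually_mono[OF eventually_nhds_in_open[of "{..<-d}"]]) auto
      ultimately show ?thesis by (subst DERIV_cong_ev[OF refl _ refl, symmetric]) auto
    next
      case 2
      have "((\<lambda>s. (s + d)\<^sup>2) has_real_derivative 2 * max 0 (s + d)) (at s)"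
        using 2 by (auto intro!: derivative_eq_intros)
      moreover have "\<forall>\<^sub>F r in nhds s. (r + d)\<^sup>2 = (max 0 (r + d))\<^sup>2"
        using 2 by (intro eventually_mono[OF eventually_nhds_in_open[of "{-d<..}"]]) auto
      ultimately show ?thesis by (subst DERIV_cong_ev[OF refl _ refl, symmetric]) auto
    qed
  qed
  then show ?thesis by (rule has_field_derivative_at_within)
qed

text \<open>Formally, testing with \<open>exp (k s)\<close> cut off below \<open>-d\<close> gives
  \<open>Gam d k (y a) = exp (-k d) y\<^sup>0(a + d) + k \<integral>\<^sub>a\<^sup>a\<^sup>+\<^sup>d exp (k (a - w)) y\<^sup>0(w) dw\<close>. The jump is smoothed to
  obtain admissible, still increasing, test functions.\<close>

lemma (in delay_solution) Gam_nonneg: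
  assumes nonneg: "\<And>t. 0 \<le> t \<Longrightarrow> 0 \<le> fst (y t)" and "0 \<le> k" and "0 \<le> a"
  shows "0 \<le> Gam d k (y a)"
proof -
  let ?m = "\<lambda>s. max 0 (s + d)"
  \<comment> \<open>As \<open>n\<close> grows, the second factor tends to the indicator of
    \<open>s > -d\<close>. Both factors are nonnegative and, for \<open>k \<ge> 0\<close>,
    nondecreasing, so \<open>q n\<close> is nonnegative.\<close>
  define P where "P n s = exp (k * s) * (1 - exp (- (real n * (?m s)\<^sup>2)))" for n s
  define q where "q n s = k * P n s + exp (k * s) * (exp (- (real n * (?m s)\<^sup>2)) * (real n * (2 * ?m s)))" for n s
  have P: "(P n has_real_derivative q n s) (at s within A)" for n s A
  proof -
    define g where "g s = (?m s)\<^sup>2" for s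
    have g: "(g has_real_derivative 2 * ?m s) (at s within A)"
      unfolding g_def by (rule DERIV_max_0_power2)
    show ?thesis
      unfolding P_def q_def g_def[symmetric]
      by (auto intro!: derivative_eq_intros g simp: algebra_simps)
  qed
  have q: "continuous_on A (q n)" for A n
    unfolding q_def P_def by (intro continuous_intros)
  have P_0: "P n s = 0" if "s \<le> - d" for n s using that by (simp add: P_def)
  have P_nonneg: "0 \<le> P n s" and P_le: "P n s \<le> exp (k * s)" for n s
    by (auto simp: P_def mult_le_cancel_left1)
  have q_nonneg: "0 \<le> q n s" for n s
    using P_nonneg[of n s] \<open>0 \<le> k\<close> by (auto simp: q_def)
  \<comment> \<open>Transport over exactly the time \<open>d\<close> pushes the terminal state and
    the control out of the support of \<open>P n\<close>; what is left is the integral of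
    \<open>q n\<close> against the nonnegative \<open>y\<^sup>0\<close>.\<close>
  have pos: "0 \<le> P n 0 * fst (y a) + (LINT s|lebesgue_on {-d..0}. P n s * snd (y a) s)" for n
  proof -
    have "(LINT s|lebesgue_on {-d..0}. P n (s - d) * snd (y (a + d)) s) = (LINT s|lebesgue_on {-d..0}. 0)"
      by (rule Bochner_Integration.integral_cong) (auto simp: P_0)
    moreover have "(LINT w|lebesgue_on {a..a+d}. P n (a - d - w) * u w) = (LINT w|lebesgue_on {a..a+d}. 0)"
      by (rule Bochner_Integration.integral_cong) (auto simp: P_0)
    moreover have "0 \<le> (LINT w|lebesgue_on {a..a+d}. q n (a - w) * fst (y w))"
      using \<open>0 \<le> a\<close> by (intro Bochner_Integration.integral_nonneg) (auto simp: q_nonneg nonneg)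
    ultimately show ?thesis
      using transport_identity[of a d "q n" "P n"] q P P_0[of "-d" n] d_pos \<open>0 \<le> a\<close> by simp
  qed
  have lim: "(\<lambda>n. P n s) \<longlonglongrightarrow> exp (k * s)" if "- d < s" for s
  proof -
    have "(\<lambda>n. exp (- (?m s)\<^sup>2) ^ n) \<longlonglongrightarrow> 0"
      using that by (intro LIMSEQ_realpow_zero) auto
    then have "(\<lambda>n. exp (- (real n * (?m s)\<^sup>2))) \<longlonglongrightarrow> 0"
      by (simp add: exp_of_nat_mult[symmetric])
    then have "(\<lambda>n. P n s) \<longlonglongrightarrow> exp (k * s) * (1 - 0)"
      unfolding P_def by (intro tendsto_intros)
    then show ?thesis by simp
  qed
  have "(\<lambda>n. LINT s|lebesgue_on {-d..0}. P n s * snd (y a) s)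
      \<longlonglongrightarrow> (LINT s|lebesgue_on {-d..0}. exp (k * s) * snd (y a) s)"
  proof (rule integral_dominated_convergence[where w = "\<lambda>s. \<bar>snd (y a) s\<bar>"])
    note int = snd_integrable[OF \<open>0 \<le> a\<close>]
    show "(\<lambda>s. exp (k * s) * snd (y a) s) \<in> borel_measurable (lebesgue_on {-d..0})"
      by (intro borel_measurable_integrable integrable_continuous_mult int continuous_intros)
    show "(\<lambda>s. P n s * snd (y a) s) \<in> borel_measurable (lebesgue_on {-d..0})" for n
      by (intro borel_measurable_integrable integrable_continuous_mult int DERIV_continuous_on[OF P])
    \<comment> \<open>\<open>P n\<close> is 0 at \<open>-d\<close> for all \<open>n\<close>, so
      convergence to the exponential fails at this one point.\<close>
    have "AE s in lebesgue_on {-d..0}. s \<noteq> - d"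
      using AE_completion[OF AE_lborel_singleton[of "-d"]] by (auto simp: AE_restrict_space_iff)
    moreover have "AE s in lebesgue_on {-d..0}. s \<in> {-d..0}"
      by (simp add: AE_restrict_space_iff)
    ultimately show "AE s in lebesgue_on {-d..0}. (\<lambda>n. P n s * snd (y a) s) \<longlonglongrightarrow> exp (k * s) * snd (y a) s"
      by eventually_elim (auto intro!: tendsto_mult_right lim)
    have "AE s in lebesgue_on {-d..0}. s \<in> {-d..0}"
      by (simp add: AE_restrict_space_iff)
    then show "AE s in lebesgue_on {-d..0}. norm (P n s * snd (y a) s) \<le> \<bar>snd (y a) s\<bar>" for n
    proof eventually_elim
      fix s assume "s \<in> {-d..0}"
      then have "exp (k * s) \<le> 1" using \<open>0 \<le> k\<close> by (simp add: mult_nonneg_nonpos)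
      then have "\<bar>P n s\<bar> \<le> 1" using P_nonneg[of n s] P_le[of n s] by linarith
      then show "norm (P n s * snd (y a) s) \<le> \<bar>snd (y a) s\<bar>"
        by (simp add: abs_mult mult_left_le_one_le)
    qed
  qed (use snd_integrable[OF \<open>0 \<le> a\<close>] in auto)
  then have "(\<lambda>n. P n 0 * fst (y a) + (LINT s|lebesgue_on {-d..0}. P n s * snd (y a) s))
      \<longlonglongrightarrow> exp (k * 0) * fst (y a) + (LINT s|lebesgue_on {-d..0}. exp (k * s) * snd (y a) s)"
    using lim[of 0] d_pos by (intro tendsto_intros) auto
  then have "0 \<le> exp (k * 0) * fst (y a) + (LINT s|lebesgue_on {-d..0}. exp (k * s) * snd (y a) s)"
    by (rule LIMSEQ_le_const) (use pos in auto)
  then show ?thesis by (simp add: Gam_def)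
qed

section \<open>Budget constraint on discounted consumption\<close>

lemma nn_integral_Ici_le:
  fixes f :: "real \<Rightarrow> ennreal"
  assumes f: "f \<in> borel_measurable (lebesgue_on {0..})"
    and B: "\<And>n::nat. (\<integral>\<^sup>+t. f t \<partial>lebesgue_on {0..real n}) \<le> B"
  shows "(\<integral>\<^sup>+t. f t \<partial>lebesgue_on {0..}) \<le> B"
proof -
  define F where "F n t = f t * indicator {0..} t * indicator {..real n} t" for n :: nat and t
  have meas: "F n \<in> borel_measurable lebesgue" for n
  proof -
    have "(\<lambda>t. f t * indicator {0..} t) \<in> borel_measurable lebesgue"
      using f by (simp add: borel_measurable_restrict_space_iff_ennreal)
    moreover have "(\<lambda>t. indicator {..real n} t :: ennreal) \<in> borel_measurable lebesgue"
      by (rule borel_measurable_indicator) simp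
    ultimately show ?thesis unfolding F_def by (rule borel_measurable_times_ennreal)
  qed
  have "incseq F"
    unfolding F_def incseq_def le_fun_def by (auto simp: indicator_def)
  have SUP: "(SUP n. F n t) = f t * indicator {0..} t" for t
  proof (rule antisym)
    show "(SUP n. F n t) \<le> f t * indicator {0..} t"
      by (rule SUP_least) (auto simp: F_def indicator_def)
    obtain n :: nat where "t \<le> real n" using real_arch_simple by blast
    then have "f t * indicator {0..} t = F n t" by (simp add: F_def)
    then show "f t * indicator {0..} t \<le> (SUP n. F n t)" by (metis SUP_upper UNIV_I)
  qed
  have "(\<integral>\<^sup>+t. f t \<partial>lebesgue_on {0..}) = (\<integral>\<^sup>+t. (SUP n. F n t) \<partial>lebesgue)"
    unfolding SUP by (simp add: nn_integral_restrict_space)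
  also have "\<dots> = (SUP n. \<integral>\<^sup>+t. F n t \<partial>lebesgue)"
    using \<open>incseq F\<close> meas by (rule nn_integral_monotone_convergence_SUP)
  also have "\<dots> \<le> B"
  proof (rule SUP_least)
    fix n :: nat
    have "F n = (\<lambda>t. f t * indicator {0..real n} t)"
      by (auto simp: F_def indicator_def)
    then have "(\<integral>\<^sup>+t. F n t \<partial>lebesgue) = (\<integral>\<^sup>+t. f t \<partial>lebesgue_on {0..real n})"
      by (simp add: nn_integral_restrict_space)
    then show "(\<integral>\<^sup>+t. F n t \<partial>lebesgue) \<le> B" using B by simp
  qed
  finally show ?thesis .
qed

lemma (in delay_solution) consumption_measurable:
  "(\<lambda>t. fst (y t) - u t) \<in> borel_measurable (lebesgue_on {0..})"
proof (rule borel_measurable_diff)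
  show "(\<lambda>t. fst (y t)) \<in> borel_measurable (lebesgue_on {0..})"
    by (rule continuous_imp_measurable_on_sets_lebesgue[OF continuous_fst]) simp
qed (use u_L2loc in \<open>simp add: L2loc_def\<close>)

text \<open>On \<open>{0..real n}\<close> the integral equals \<open>(Gam d \<xi> (y 0) - exp (-
  (\<xi> * n)) * Gam d \<xi> (y n)) / \<xi>\<close>, and \<open>Gam_nonneg\<close> discards the last
  term. The nonnegative integral is used because integrability over \<open>{0..}\<close> is only a
  consequence of the bound.\<close>

lemma (in delay_solution) discounted_consumption_le:
  assumes nonneg: "\<And>t. 0 \<le> t \<Longrightarrow> 0 \<le> fst (y t)" and u_le: "AE t in lebesgue_on {0..}. u t \<le> fst (y t)"
    and \<xi>: "\<xi> > 0" "\<xi> = At * exp (- \<xi> * d)"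
  shows "(\<integral>\<^sup>+t. ennreal (exp (- (\<xi> * t)) * (fst (y t) - u t)) \<partial>lebesgue_on {0..}) \<le> ennreal (Gam d \<xi> (y 0) / \<xi>)"
proof (rule nn_integral_Ici_le)
  let ?f = "\<lambda>t. exp (- (\<xi> * t)) * (fst (y t) - u t)"
  have expm: "(\<lambda>t. exp (- (\<xi> * t))) \<in> borel_measurable (lebesgue_on {0..})"
    by (rule continuous_imp_measurable_on_sets_lebesgue) (auto intro!: continuous_intros)
  then show "(\<lambda>t. ennreal (?f t)) \<in> borel_measurable (lebesgue_on {0..})"
    using consumption_measurable by measurable
  fix n :: nat
  have int: "integrable (lebesgue_on {0..real n}) ?f"
    by (intro integrable_continuous_mult continuous_intros Bochner_Integration.integrable_diff u_integrable
        continuous_imp_integrable_real continuous_on_subset[OF continuous_fst]) auto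
  have "AE t in lebesgue_on {0..real n}. 0 \<le> ?f t"
    using u_le by (auto simp: AE_restrict_space_iff)
  then have "(\<integral>\<^sup>+t. ennreal (?f t) \<partial>lebesgue_on {0..real n}) = ennreal (LINT t|lebesgue_on {0..real n}. ?f t)"
    by (rule nn_integral_eq_integral[OF int])
  also have "\<dots> \<le> ennreal (Gam d \<xi> (y 0) / \<xi>)"
  proof (rule ennreal_leI)
    have "At * exp (- (\<xi> * d)) = \<xi>" using \<xi>(2) by simp
    then have "exp (- (\<xi> * n)) * Gam d \<xi> (y n) - Gam d \<xi> (y 0)
      = (LINT t|lebesgue_on {0..real n}. exp (- (\<xi> * t)) * (\<xi> * u t - \<xi> * fst (y t)))"
      using weighted_Gam_increment[of 0 "real n" \<xi>] by simp
    also have "\<dots> = (LINT t|lebesgue_on {0..real n}. - \<xi> * ?f t)"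
      by (simp add: algebra_simps)
    also have "\<dots> = - \<xi> * (LINT t|lebesgue_on {0..real n}. ?f t)"
      by (rule integral_mult_right_zero)
    finally have "\<xi> * (LINT t|lebesgue_on {0..real n}. ?f t) = Gam d \<xi> (y 0) - exp (- (\<xi> * n)) * Gam d \<xi> (y n)"
      by simp
    also have "\<dots> \<le> Gam d \<xi> (y 0)"
      using Gam_nonneg[OF nonneg, of \<xi> n] \<xi>(1) by simp
    finally show "(LINT t|lebesgue_on {0..real n}. ?f t) \<le> Gam d \<xi> (y 0) / \<xi>"
      using \<xi>(1) by (simp add: field_simps)
  qed
  finally show "(\<integral>\<^sup>+t. ennreal (?f t) \<partial>lebesgue_on {0..real n}) \<le> ennreal (Gam d \<xi> (y 0) / \<xi>)" .
qed

section \<open>Concave utility\<close>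

text \<open>Tangent at \<open>c\<^sub>0\<close>: as \<open>c\<^sub>0 powr (- \<sigma>) * c\<^sub>0 =
  c\<^sub>0 powr (1 - \<sigma>)\<close>, the constant part collects to the coefficient
  \<open>1 / (1 - \<sigma>) - 1 = \<sigma> / (1 - \<sigma>)\<close>.\<close>

lemma powr_concave_tangent:
  fixes \<sigma> c c\<^sub>0 :: real
  assumes "\<sigma> > 0" "\<sigma> \<noteq> 1" "c > 0" "c\<^sub>0 > 0"
  shows "c powr (1 - \<sigma>) / (1 - \<sigma>) \<le> \<sigma> / (1 - \<sigma>) * c\<^sub>0 powr (1 - \<sigma>) + c\<^sub>0 powr (- \<sigma>) * c"
proof -
  let ?f = "\<lambda>z. - (z powr (1 - \<sigma>) / (1 - \<sigma>))" and ?f' = "\<lambda>z. - (z powr (- \<sigma>))"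
  have deriv: "(?f has_real_derivative ?f' z) (at z)" if "z > 0" for z
    using that \<open>\<sigma> \<noteq> 1\<close> by (auto intro!: derivative_eq_intros)
  have "convex_on {0<..} ?f"
  proof (rule convex_on_realI)
    fix z w :: real assume "z \<in> {0<..}" "z \<le> w"
    then show "?f' z \<le> ?f' w" using \<open>\<sigma> > 0\<close> by (simp add: powr_mono2')
  qed (use deriv in auto)
  then have "?f' c\<^sub>0 * (c - c\<^sub>0) \<le> ?f c - ?f c\<^sub>0"
  proof (rule convex_on_imp_above_tangent)
    show "(?f has_real_derivative ?f' c\<^sub>0) (at c\<^sub>0 within {0<..})"
      using deriv[OF \<open>c\<^sub>0 > 0\<close>] by (rule has_field_derivative_at_within)
  qed (use assms in \<open>auto simp: interior_open\<close>)
  moreover have "c\<^sub>0 powr (- \<sigma>) * c\<^sub>0 = c\<^sub>0 powr (1 - \<sigma>)"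
    using \<open>c\<^sub>0 > 0\<close> powr_add[of c\<^sub>0 "- \<sigma>" 1] by simp
  moreover have "z / (1 - \<sigma>) - z = \<sigma> / (1 - \<sigma>) * z" for z
    using \<open>\<sigma> \<noteq> 1\<close> by (simp add: field_simps)
  from this[of "c\<^sub>0 powr (1 - \<sigma>)"]
  have "c\<^sub>0 powr (1 - \<sigma>) / (1 - \<sigma>) - c\<^sub>0 powr (1 - \<sigma>) = \<sigma> / (1 - \<sigma>) * c\<^sub>0 powr (1 - \<sigma>)" .
  ultimately show ?thesis by (simp add: right_diff_distrib)
qed

lemma nn_integral_exp_Ici:
  assumes "m > 0" and "B \<ge> 0"
  shows "(\<integral>\<^sup>+t. ennreal (B * exp (- (m * t))) \<partial>lebesgue_on {0..}) = ennreal (B / m)"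
proof -
  have "(\<integral>\<^sup>+t. ennreal (B * exp (- (m * t))) \<partial>lebesgue_on {0..})
      = (\<integral>\<^sup>+t. ennreal (B * exp (- (m * t))) * indicator {0..} t \<partial>lborel)"
    by (simp add: nn_integral_restrict_space nn_integral_completion)
  also have "\<dots> = ennreal (0 - (- (B / m) * exp (- (m * 0))))"
  proof (rule nn_integral_FTC_atLeast)
    show "((\<lambda>t. - (B / m) * exp (- (m * t))) \<longlongrightarrow> 0) at_top"
    proof -
      have "filterlim (\<lambda>t. - (m * t)) at_bot at_top"
        using \<open>m > 0\<close> by (simp add: filterlim_uminus_at_bot filterlim_tendsto_pos_mult_at_top[OF tendsto_const _ filterlim_ident])
      then have "((\<lambda>t. exp (- (m * t))) \<longlongrightarrow> 0) at_top"
        by (rule filterlim_compose[OF exp_at_bot])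
      then show ?thesis by (rule tendsto_mult_right_zero)
    qed
  qed (use assms in \<open>auto intro!: derivative_eq_intros\<close>)
  finally show ?thesis by simp
qed

text \<open>\<open>K exp (\<xi> (1 - \<alpha>) t)\<close> is the optimal consumption path; the choice of \<open>\<alpha>\<close> makes its discounted
  marginal utility a multiple of \<open>exp (- \<xi> t)\<close>, the price entering the budget constraint.\<close>

locale growth_parameters =
  fixes \<rho> \<sigma> \<xi> \<alpha> :: real
  assumes \<sigma>: "\<sigma> > 0" "\<sigma> \<noteq> 1" and \<xi>: "\<xi> > 0" and \<rho>: "\<rho> > \<xi> * (1 - \<sigma>)"
    and \<alpha>: "\<alpha> = (\<rho> - \<xi> * (1 - \<sigma>)) / (\<sigma> * \<xi>)"
begin

lemma \<alpha>_pos: "\<alpha> > 0"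
  unfolding \<alpha> using \<sigma>(1) \<xi> \<rho> by simp

lemma \<rho>_eq: "\<rho> = \<sigma> * \<xi> * \<alpha> + \<xi> * (1 - \<sigma>)"
  unfolding \<alpha> using \<sigma>(1) \<xi> by simp

text \<open>By \<open>\<rho>_eq\<close> the exponent
  \<open>- \<rho> + \<xi> * (1 - \<alpha>) * (1 - \<sigma>)\<close> equals
  \<open>- (\<xi> * \<alpha>)\<close>, which is negative for both signs of
  \<open>1 - \<sigma>\<close>; thus the candidate path always has finite utility.\<close>

lemma discounted_optimal_utility:
  "exp (- \<rho> * t) * (K * exp (\<xi> * (1 - \<alpha>) * t)) powr (1 - \<sigma>) = K powr (1 - \<sigma>) * exp (- (\<xi> * \<alpha> * t))"
  if "K > 0"
proof -
  have "exp (- \<rho> * t) * exp (\<xi> * (1 - \<alpha>) * t * (1 - \<sigma>)) = exp (- (\<xi> * \<alpha> * t))"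
    unfolding exp_add[symmetric] by (simp add: \<rho>_eq algebra_simps)
  then show ?thesis using that by (simp add: powr_mult exp_powr_real mult_ac)
qed

lemma discounted_marginal_utility:
  "exp (- \<rho> * t) * (K * exp (\<xi> * (1 - \<alpha>) * t)) powr (- \<sigma>) = K powr (- \<sigma>) * exp (- (\<xi> * t))"
  if "K > 0"
proof -
  have "exp (- \<rho> * t) * exp (\<xi> * (1 - \<alpha>) * t * (- \<sigma>)) = exp (- (\<xi> * t))"
    unfolding exp_add[symmetric] by (simp add: \<rho>_eq algebra_simps)
  then show ?thesis using that by (simp add: powr_mult exp_powr_real mult_ac)
qed

lemma discounted_tangent:
  assumes "K > 0" and "c > 0"
  shows "exp (- \<rho> * t) * (c powr (1 - \<sigma>) / (1 - \<sigma>))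
    \<le> \<sigma> / (1 - \<sigma>) * K powr (1 - \<sigma>) * exp (- (\<xi> * \<alpha> * t)) + K powr (- \<sigma>) * (exp (- (\<xi> * t)) * c)"
proof -
  let ?c = "K * exp (\<xi> * (1 - \<alpha>) * t)"
  have "exp (- \<rho> * t) * (c powr (1 - \<sigma>) / (1 - \<sigma>))
      \<le> exp (- \<rho> * t) * (\<sigma> / (1 - \<sigma>) * ?c powr (1 - \<sigma>) + ?c powr (- \<sigma>) * c)"
    using assms \<sigma> by (intro mult_left_mono powr_concave_tangent) auto
  also have "\<dots> = \<sigma> / (1 - \<sigma>) * (exp (- \<rho> * t) * ?c powr (1 - \<sigma>)) + (exp (- \<rho> * t) * ?c powr (- \<sigma>)) * c"
    by (simp add: algebra_simps)
  also have "\<dots> = \<sigma> / (1 - \<sigma>) * K powr (1 - \<sigma>) * exp (- (\<xi> * \<alpha> * t)) + K powr (- \<sigma>) * (exp (- (\<xi> * t)) * c)"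
    unfolding discounted_optimal_utility[OF \<open>K > 0\<close>] discounted_marginal_utility[OF \<open>K > 0\<close>] by simp
  finally show ?thesis .
qed

section \<open>Extended-real integrals of discounted utility\<close>

abbreviation discounted_utility :: "(real \<Rightarrow> real) \<Rightarrow> real \<Rightarrow> ereal" where
  "discounted_utility c t \<equiv> ereal (exp (- \<rho> * t)) * utility \<sigma> (c t)"

lemma ereal_integral_utility_less_1:
  assumes "\<sigma> < 1"
  shows "ereal_integral M (discounted_utility c)
    = enn2ereal (\<integral>\<^sup>+t. ennreal (exp (- \<rho> * t) * (c t powr (1 - \<sigma>) / (1 - \<sigma>))) \<partial>M)"
proof -
  have "discounted_utility c t = ereal (exp (- \<rho> * t) * (c t powr (1 - \<sigma>) / (1 - \<sigma>)))" for t
    using assms by (simp add: utility_def)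
  moreover have "0 \<le> exp (- \<rho> * t) * (c t powr (1 - \<sigma>) / (1 - \<sigma>))" for t
    using assms by simp
  ultimately show ?thesis
    unfolding ereal_integral_def by (simp add: ennreal_neg zero_ennreal.rep_eq)
qed

text \<open>The value at \<open>c t = 0\<close> is listed separately since \<open>powr\<close> would
  give 0 there, while zero consumption costs \<infinity>.\<close>

lemma ereal_integral_utility_greater_1:
  assumes "\<sigma> > 1"
  shows "ereal_integral M (discounted_utility c)
    = - enn2ereal (\<integral>\<^sup>+t. (if c t = 0 then \<infinity> else ennreal (exp (- \<rho> * t) * (c t powr (1 - \<sigma>) / (\<sigma> - 1)))) \<partial>M)"
proof -
  have neg: "e2ennreal (- discounted_utility c t)
      = (if c t = 0 then \<infinity> else ennreal (exp (- \<rho> * t) * (c t powr (1 - \<sigma>) / (\<sigma> - 1))))" for t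
  proof -
    have "- (c t powr (1 - \<sigma>) / (1 - \<sigma>)) = c t powr (1 - \<sigma>) / (\<sigma> - 1)"
      using assms by (simp add: field_simps)
    then have "- (exp (- \<rho> * t) * (c t powr (1 - \<sigma>) / (1 - \<sigma>))) = exp (- \<rho> * t) * (c t powr (1 - \<sigma>) / (\<sigma> - 1))"
      by (metis mult_minus_right)
    then show ?thesis using assms by (auto simp: utility_def)
  qed
  have "discounted_utility c t \<le> 0" for t
    using assms by (auto simp: utility_def divide_nonneg_neg mult_nonneg_nonpos)
  then have "e2ennreal (discounted_utility c t) = 0" for t
    by (rule e2ennreal_neg)
  then show ?thesis unfolding ereal_integral_def neg by (simp add: zero_ennreal.rep_eq)
qed

text \<open>The coefficient \<open>b\<close> will be \<open>1 / (1 - \<sigma>)\<close> or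
  \<open>1 / (\<sigma> - 1)\<close>, whichever is positive. Dividing
  \<open>(\<alpha> * G) powr (1 - \<sigma>)\<close> by the decay rate
  \<open>\<xi> * \<alpha>\<close> is where the factor \<nu> comes from.\<close>

lemma discounted_optimal_utility_integral:
  assumes "G > 0" and "b \<ge> 0"
  shows "(\<integral>\<^sup>+t. ennreal (exp (- \<rho> * t) * (b * (\<alpha> * G * exp (\<xi> * (1 - \<alpha>) * t)) powr (1 - \<sigma>))) \<partial>lebesgue_on {0..})
    = ennreal (b * (\<alpha> powr (- \<sigma>) * (1 / \<xi>) * G powr (1 - \<sigma>)))"
proof -
  have K: "\<alpha> * G > 0" using \<alpha>_pos assms(1) by simp
  have eq: "exp (- \<rho> * t) * (b * (\<alpha> * G * exp (\<xi> * (1 - \<alpha>) * t)) powr (1 - \<sigma>))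
      = b * (\<alpha> * G) powr (1 - \<sigma>) * exp (- (\<xi> * \<alpha> * t))" for t
    using discounted_optimal_utility[OF K, of t] by (metis mult.assoc mult.left_commute)
  have "b * (\<alpha> * G) powr (1 - \<sigma>) / (\<xi> * \<alpha>) = b * (\<alpha> powr (- \<sigma>) * (1 / \<xi>) * G powr (1 - \<sigma>))"
    using \<alpha>_pos \<xi> assms(1) by (simp add: powr_mult powr_diff powr_minus field_simps)
  then show ?thesis
    unfolding eq using nn_integral_exp_Ici[of "\<xi> * \<alpha>" "b * (\<alpha> * G) powr (1 - \<sigma>)"] \<alpha>_pos \<xi> assms(2)
    by simp
qed

lemma ereal_integral_optimal_utility:
  assumes "G > 0"
  shows "ereal_integral (lebesgue_on {0..}) (discounted_utility (\<lambda>t. \<alpha> * G * exp (\<xi> * (1 - \<alpha>) * t)))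
    = ereal (\<alpha> powr (- \<sigma>) * (1 / \<xi>) * (G powr (1 - \<sigma>) / (1 - \<sigma>)))"
proof (cases "\<sigma> < 1")
  case True
  then show ?thesis
    using discounted_optimal_utility_integral[OF assms, of "1 / (1 - \<sigma>)"] \<xi>
      ereal_integral_utility_less_1[OF True, of "lebesgue_on {0..}" "\<lambda>t. \<alpha> * G * exp (\<xi> * (1 - \<alpha>) * t)"]
    by (simp add: enn2ereal_ennreal mult.commute)
next
  case False
  then have "\<sigma> > 1" using \<sigma>(2) by simp
  moreover have "- (z / (\<xi> * (\<sigma> - 1))) = z / (\<xi> * (1 - \<sigma>))" for z
    using \<open>\<sigma> > 1\<close> \<xi> by (simp add: field_simps)
  ultimately show ?thesis
    using discounted_optimal_utility_integral[OF assms, of "1 / (\<sigma> - 1)"] \<xi> \<alpha>_pos assms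
      ereal_integral_utility_greater_1[of "lebesgue_on {0..}" "\<lambda>t. \<alpha> * G * exp (\<xi> * (1 - \<alpha>) * t)"]
    by (simp add: enn2ereal_ennreal mult.commute)
qed

text \<open>Integrating \<open>discounted_tangent\<close> with \<open>K = \<alpha> * G\<close> gives
  \<open>\<sigma> / (1 - \<sigma>) * W\<close> from the candidate path and, by the budget, at most
  \<open>W\<close> from the price term; they add up to \<open>W / (1 - \<sigma>)\<close>.\<close>

lemma ereal_integral_utility_le:
  assumes "G > 0" and c: "c \<in> borel_measurable (lebesgue_on {0..})"
    and nonneg: "AE t in lebesgue_on {0..}. 0 \<le> c t"
    and budget: "(\<integral>\<^sup>+t. ennreal (exp (- (\<xi> * t)) * c t) \<partial>lebesgue_on {0..}) \<le> ennreal (G / \<xi>)"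
  shows "ereal_integral (lebesgue_on {0..}) (discounted_utility c)
    \<le> ereal (\<alpha> powr (- \<sigma>) * (1 / \<xi>) * (G powr (1 - \<sigma>) / (1 - \<sigma>)))"
proof -
  let ?M = "lebesgue_on {0::real..}"
  define K where "K = \<alpha> * G"
  have K: "K > 0" using \<alpha>_pos assms(1) by (simp add: K_def)
  define W where "W = \<alpha> powr (- \<sigma>) * (1 / \<xi>) * G powr (1 - \<sigma>)"
  have W: "W > 0" using \<alpha>_pos \<xi> assms(1) by (simp add: W_def)
  \<comment> \<open>The two integrals agree precisely because \<open>K\<close> is
    \<open>\<alpha> * G\<close>.\<close>
  have KW: "K powr (1 - \<sigma>) / (\<xi> * \<alpha>) = W" "K powr (- \<sigma>) * (G / \<xi>) = W"
    using \<alpha>_pos \<xi> assms(1) by (simp_all add: K_def W_def powr_mult powr_diff powr_minus field_simps)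
  let ?a = "\<lambda>t. K powr (1 - \<sigma>) * exp (- (\<xi> * \<alpha> * t))" and ?c = "\<lambda>t. exp (- (\<xi> * t)) * c t"
  have expm: "(\<lambda>t. exp (r * t)) \<in> borel_measurable ?M" for r :: real
    by (rule continuous_imp_measurable_on_sets_lebesgue) (auto intro!: continuous_intros)
  have am: "?a \<in> borel_measurable ?M" and cm: "?c \<in> borel_measurable ?M"
    using expm[of "- (\<xi> * \<alpha>)"] expm[of "- \<xi>"] c by (auto simp: mult.assoc)
  have am': "(\<lambda>t. ennreal (b * ?a t)) \<in> borel_measurable ?M" for b
    using borel_measurable_times[OF borel_measurable_const am] by (rule measurable_compose) simp
  have cm': "(\<lambda>t. ennreal (?c t)) \<in> borel_measurable ?M"
    using cm by (rule measurable_compose) simp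
  have price: "(\<integral>\<^sup>+t. ennreal (K powr (- \<sigma>)) * ennreal (?c t) \<partial>?M) \<le> ennreal W"
  proof -
    have "(\<integral>\<^sup>+t. ennreal (K powr (- \<sigma>)) * ennreal (?c t) \<partial>?M)
        = ennreal (K powr (- \<sigma>)) * (\<integral>\<^sup>+t. ennreal (?c t) \<partial>?M)"
      using cm' by (rule nn_integral_cmult)
    also have "\<dots> \<le> ennreal (K powr (- \<sigma>)) * ennreal (G / \<xi>)"
      using budget by (rule mult_left_mono) simp
    also have "\<dots> = ennreal W"
      using KW(2) \<xi> assms(1) by (simp flip: ennreal_mult)
    finally show ?thesis .
  qed
  have aW: "(\<integral>\<^sup>+t. ennreal (b * ?a t) \<partial>?M) = ennreal (b * W)" if "b \<ge> 0" for b
    using nn_integral_exp_Ici[of "\<xi> * \<alpha>" "b * K powr (1 - \<sigma>)"] that \<alpha>_pos \<xi> KW(1)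
    by (simp add: mult.assoc flip: times_divide_eq_right)
  show ?thesis
  proof (cases "\<sigma> < 1")
    case True
    define b where "b = \<sigma> / (1 - \<sigma>)"
    have b: "b \<ge> 0" "b * W + W = W / (1 - \<sigma>)" using True \<sigma>(1) by (auto simp: b_def field_simps)
    have "(\<integral>\<^sup>+t. ennreal (exp (- \<rho> * t) * (c t powr (1 - \<sigma>) / (1 - \<sigma>))) \<partial>?M)
        \<le> (\<integral>\<^sup>+t. ennreal (b * ?a t) + ennreal (K powr (- \<sigma>)) * ennreal (?c t) \<partial>?M)"
    proof (rule nn_integral_mono_AE)
      show "AE t in ?M. ennreal (exp (- \<rho> * t) * (c t powr (1 - \<sigma>) / (1 - \<sigma>)))
          \<le> ennreal (b * ?a t) + ennreal (K powr (- \<sigma>)) * ennreal (?c t)"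
        using nonneg
      proof eventually_elim
        case (elim t)
        have "exp (- \<rho> * t) * (c t powr (1 - \<sigma>) / (1 - \<sigma>)) \<le> b * ?a t + K powr (- \<sigma>) * ?c t"
        proof (cases "c t = 0")
          case True
          then show ?thesis using b(1) by simp
        next
          case False
          then show ?thesis using discounted_tangent[OF K, of "c t" t] elim by (simp add: b_def mult.assoc)
        qed
        then show ?case
          using b(1) elim by (simp add: ennreal_leI flip: ennreal_mult ennreal_plus)
      qed
    qed
    also have "\<dots> = (\<integral>\<^sup>+t. ennreal (b * ?a t) \<partial>?M) + (\<integral>\<^sup>+t. ennreal (K powr (- \<sigma>)) * ennreal (?c t) \<partial>?M)"
      using am' cm' by (intro nn_integral_add borel_measurable_times_ennreal borel_measurable_const)
    also have "\<dots> \<le> ennreal (b * W) + ennreal W"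
      using aW[OF b(1)] price by (intro add_mono) auto
    also have "\<dots> = ennreal (W / (1 - \<sigma>))"
      using b W by (simp flip: ennreal_plus)
    finally have "enn2ereal (\<integral>\<^sup>+t. ennreal (exp (- \<rho> * t) * (c t powr (1 - \<sigma>) / (1 - \<sigma>))) \<partial>?M)
        \<le> enn2ereal (ennreal (W / (1 - \<sigma>)))"
      by (simp only: less_eq_ennreal.rep_eq)
    also have "\<dots> = ereal (W / (1 - \<sigma>))" using W True by (simp add: enn2ereal_ennreal)
    finally show ?thesis
      using ereal_integral_utility_less_1[OF True, of ?M c] by (simp add: W_def)
  next
    case False
    then have s: "\<sigma> > 1" using \<sigma>(2) by simp
    \<comment> \<open>Now \<open>\<sigma> / (1 - \<sigma>)\<close> is negative. The tangent
      inequality is rearranged into a bound on \<open>b * ?a t\<close> so that only nonnegative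
      integrals occur, and the finite \<open>ennreal W\<close> is cancelled at the end. Where
      \<open>c t = 0\<close> the bound is trivial since \<open>?F\<close> is infinite.\<close>
    define b where "b = \<sigma> / (\<sigma> - 1)"
    have b: "b \<ge> 0" "b * W - W = W / (\<sigma> - 1)" "b * W = W / (\<sigma> - 1) + W"
      using s by (auto simp: b_def field_simps)
    let ?F = "\<lambda>t. if c t = 0 then \<infinity> else ennreal (exp (- \<rho> * t) * (c t powr (1 - \<sigma>) / (\<sigma> - 1)))"
    have Fm: "?F \<in> borel_measurable ?M"
      using c expm[of "- \<rho>"] by measurable
    have "ennreal (b * W) = (\<integral>\<^sup>+t. ennreal (b * ?a t) \<partial>?M)" using aW[OF b(1)] by simp
    also have "\<dots> \<le> (\<integral>\<^sup>+t. ?F t + ennreal (K powr (- \<sigma>)) * ennreal (?c t) \<partial>?M)"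
    proof (rule nn_integral_mono_AE)
      show "AE t in ?M. ennreal (b * ?a t) \<le> ?F t + ennreal (K powr (- \<sigma>)) * ennreal (?c t)"
        using nonneg
      proof eventually_elim
        case (elim t)
        show ?case
        proof (cases "c t = 0")
          case False
          have "\<sigma> / (1 - \<sigma>) = - b" "z / (1 - \<sigma>) = - (z / (\<sigma> - 1))" for z
            using s by (auto simp: b_def field_simps)
          then have "b * ?a t \<le> exp (- \<rho> * t) * (c t powr (1 - \<sigma>) / (\<sigma> - 1)) + K powr (- \<sigma>) * ?c t"
            using discounted_tangent[OF K, of "c t" t] elim False by (simp add: mult.assoc)
          then show ?thesis
            using False elim s by (simp add: ennreal_leI flip: ennreal_mult ennreal_plus)
        qed simp
      qed
    qed
    also have "\<dots> = (\<integral>\<^sup>+t. ?F t \<partial>?M) + (\<integral>\<^sup>+t. ennreal (K powr (- \<sigma>)) * ennreal (?c t) \<partial>?M)"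
      using Fm cm' by (intro nn_integral_add borel_measurable_times_ennreal borel_measurable_const)
    also have "\<dots> \<le> (\<integral>\<^sup>+t. ?F t \<partial>?M) + ennreal W"
      using price by (rule add_left_mono)
    finally have "ennreal (W / (\<sigma> - 1)) + ennreal W \<le> (\<integral>\<^sup>+t. ?F t \<partial>?M) + ennreal W"
      using b(3) W s by (simp flip: ennreal_plus)
    then have "ennreal (W / (\<sigma> - 1)) \<le> (\<integral>\<^sup>+t. ?F t \<partial>?M)"
      by (simp add: ennreal_add_left_cancel_le add.commute[of _ "ennreal W"])
    then have "enn2ereal (ennreal (W / (\<sigma> - 1))) \<le> enn2ereal (\<integral>\<^sup>+t. ?F t \<partial>?M)"
      by (simp only: less_eq_ennreal.rep_eq)
    moreover have "enn2ereal (ennreal (W / (\<sigma> - 1))) = ereal (W / (\<sigma> - 1))"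
      using W s by (simp add: enn2ereal_ennreal)
    ultimately have "- enn2ereal (\<integral>\<^sup>+t. ?F t \<partial>?M) \<le> - ereal (W / (\<sigma> - 1))"
      by (simp only: ereal_minus_le_minus)
    also have "- ereal (W / (\<sigma> - 1)) = ereal (W / (1 - \<sigma>))"
      using s by (simp add: field_simps)
    finally show ?thesis
      using ereal_integral_utility_greater_1[OF s, of ?M c] by (simp add: W_def)
  qed
qed

end

lemma Gam_eqX:
  assumes "x \<in> X_space d" "z \<in> X_space d" "eqX d x z"
  shows "Gam d k x = Gam d k z"
proof -
  have meas: "(\<lambda>s. exp (k * s) * snd v s) \<in> borel_measurable (lebesgue_on {-d..0})" if "v \<in> X_space d" for v
    using that by (intro borel_measurable_integrable integrable_continuous_mult continuous_intros L2_hist_integrable)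
      (auto simp: X_space_def)
  have "AE s in lebesgue_on {-d..0}. snd x s = snd z s" using assms(3) by (simp add: eqX_def)
  then have "AE s in lebesgue_on {-d..0}. exp (k * s) * snd x s = exp (k * s) * snd z s"
    by eventually_elim simp
  then have "(LINT s|lebesgue_on {-d..0}. exp (k * s) * snd x s) = (LINT s|lebesgue_on {-d..0}. exp (k * s) * snd z s)"
    by (rule integral_cong_AE[OF meas[OF assms(1)] meas[OF assms(2)]])
  then show ?thesis using assms(3) by (simp add: Gam_def eqX_def)
qed

section \<open>Objective of a solution and the closed loop\<close>

context delay_solution
begin

text \<open>The trajectory is picked by \<open>SOME\<close>, so a solution at hand may be a
  different one; uniqueness of \<open>y\<^sup>0\<close> makes the objective independent of the
  choice.\<close>

lemma fst_trajectory:
  assumes "0 \<le> t" shows "fst (trajectory d At x u t) = fst (y t)"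
proof -
  have "solves d At x u (trajectory d At x u)"
    unfolding trajectory_def using solves by (rule someI[where P = "solves d At x u"])
  then show ?thesis
    using delay_solution_fst_unique[OF delay_solutionI[OF d_pos u_L2loc] delay_solutionI[OF d_pos u_L2loc solves] assms]
    by blast
qed

lemma objective_eq:
  assumes "\<And>t. 0 \<le> t \<Longrightarrow> fst (y t) - u t = c t"
  shows "objective d At \<rho> \<sigma> x u
    = ereal_integral (lebesgue_on {0..}) (\<lambda>t. ereal (exp (- \<rho> * t)) * utility \<sigma> (c t))"
  unfolding objective_def ereal_integral_def
  by (intro arg_cong2[where f = minus] arg_cong[where f = enn2ereal] nn_integral_cong)
    (simp_all add: fst_trajectory assms)

text \<open>Under the feedback, consumption is \<open>\<alpha> * Gam d \<xi> (y t)\<close>, so the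
  discounted quantity \<open>H\<close> decays at rate \<open>\<xi> * \<alpha>\<close>, in integrated
  form. A second integrating factor, \<open>exp (\<xi> * \<alpha> * t)\<close>, makes it constant:
  the integrand in the product rule vanishes identically.\<close>

lemma Gam_closed_loop:
  assumes u: "\<And>t. 0 \<le> t \<Longrightarrow> u t = feedback d \<xi> \<alpha> (y t)" and \<xi>: "\<xi> = At * exp (- \<xi> * d)" and "0 \<le> t"
  shows "Gam d \<xi> (y t) = Gam d \<xi> (y 0) * exp (\<xi> * (1 - \<alpha>) * t)"
proof -
  define H where "H t = exp (- (\<xi> * t)) * Gam d \<xi> (y t)" for t
  have "continuous_on {0..t} H"
    unfolding H_def by (intro continuous_on_mult continuous_on_subset[OF continuous_Gam] continuous_intros) auto
  then have int: "integrable (lebesgue_on {0..t}) (\<lambda>w. - (\<xi> * \<alpha>) * H w)"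
    by (intro integrable_mult_right continuous_imp_integrable_real)
  have "H b - H a = (LINT w|lebesgue_on {a..b}. - (\<xi> * \<alpha>) * H w)" if "0 \<le> a" "a \<le> b" for a b
  proof -
    have e: "At * exp (- (\<xi> * d)) = \<xi>" using \<xi> by simp
    have "H b - H a = (LINT w|lebesgue_on {a..b}. exp (- (\<xi> * w)) * (At * exp (- (\<xi> * d)) * u w - \<xi> * fst (y w)))"
      unfolding H_def using weighted_Gam_increment[OF that, of \<xi>] .
    also have "\<dots> = (LINT w|lebesgue_on {a..b}. - (\<xi> * \<alpha>) * H w)"
      unfolding e H_def using that
      by (intro Bochner_Integration.integral_cong) (auto simp: u feedback_def algebra_simps)
    finally show ?thesis .
  qed
  then have "exp (\<xi> * \<alpha> * t) * H t - exp (\<xi> * \<alpha> * 0) * H 0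
      = (LINT w|lebesgue_on {0..t}. \<xi> * \<alpha> * exp (\<xi> * \<alpha> * w) * H w + exp (\<xi> * \<alpha> * w) * (- (\<xi> * \<alpha>) * H w))"
    by (intro integral_product_rule[OF \<open>0 \<le> t\<close> int] continuous_intros)
      (auto intro!: derivative_eq_intros)
  then have const: "exp (\<xi> * \<alpha> * t) * H t = H 0" by (simp add: algebra_simps)
  have "Gam d \<xi> (y t) = exp (\<xi> * (1 - \<alpha>) * t) * (exp (\<xi> * \<alpha> * t) * H t)"
    unfolding H_def mult.assoc[symmetric] exp_add[symmetric] by (simp add: algebra_simps)
  also have "\<dots> = Gam d \<xi> (y 0) * exp (\<xi> * (1 - \<alpha>) * t)"
    unfolding const by (simp add: H_def)
  finally show ?thesis .
qed

end

section \<open>Optimality of the feedback\<close>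

theorem proposition5p22:
  fixes A \<delta> At d \<rho> \<sigma> \<xi> \<alpha> \<nu> :: real and x :: state and y :: "real \<Rightarrow> state"
  assumes "A > 0" and "\<delta> \<ge> 0" and "At = A - \<delta>" and "At > 0"
    and "d > 0" and "\<rho> > 0" and "\<sigma> > 0" and "\<sigma> \<noteq> 1"
    and "\<xi> > 0" and "\<xi> = At * exp (- \<xi> * d)"
    and "\<rho> > \<xi> * (1 - \<sigma>)"
    and "\<alpha> = (\<rho> - \<xi> * (1 - \<sigma>)) / (\<sigma> * \<xi>)"
    and "\<nu> = \<alpha> powr (- \<sigma>) * (1 / \<xi>)"
    and "x \<in> O_set d A At \<xi> \<alpha>"
    and "fst x > 0" and "AE s in lebesgue_on {-d..0}. snd x s > 0"
    and "solves d At x (\<lambda>t. feedback d \<xi> \<alpha> (y t)) y"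
    and "\<forall>t\<ge>0. y t \<in> O_set d A At \<xi> \<alpha>"
  shows "optimal d A At \<rho> \<sigma> x (\<lambda>t. feedback d \<xi> \<alpha> (y t)) \<and>
         value_fun d A At \<rho> \<sigma> x = ereal (\<nu> * (Gam d \<xi> x powr (1 - \<sigma>) / (1 - \<sigma>)))"
proof -
  interpret growth_parameters \<rho> \<sigma> \<xi> \<alpha> using assms by unfold_locales
  let ?u = "\<lambda>t. feedback d \<xi> \<alpha> (y t)"
  let ?v = "ereal (\<nu> * (Gam d \<xi> x powr (1 - \<sigma>) / (1 - \<sigma>)))"
  interpret path: state_path d y
    using \<open>d > 0\<close> \<open>solves d At x ?u y\<close> by unfold_locales (auto simp: solves_def)
  have cont_u: "continuous_on {0..} ?u"
    unfolding feedback_def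
    by (intro continuous_on_diff continuous_on_mult_left path.continuous_fst path.continuous_Gam)
  have u_L2loc: "?u \<in> L2loc"
    unfolding L2loc_def
  proof (intro CollectI conjI allI impI)
    show "?u \<in> borel_measurable (lebesgue_on {0..})"
      by (rule continuous_imp_measurable_on_sets_lebesgue[OF cont_u]) simp
    show "integrable (lebesgue_on {0..T}) (\<lambda>t. (?u t)\<^sup>2)" for T
      by (rule continuous_imp_integrable_real, rule continuous_on_power, rule continuous_on_subset[OF cont_u]) auto
  qed
  interpret closed: delay_solution d At x ?u y
    by (rule delay_solutionI) fact+
  have G: "Gam d \<xi> x > 0" and x: "x \<in> X_space d"
    using \<open>x \<in> O_set d A At \<xi> \<alpha>\<close> by (auto simp: O_set_def Q_set_def)
  have Gam_0: "Gam d \<xi> (z 0) = Gam d \<xi> x" if "delay_solution d At x u z" for u z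
  proof -
    interpret delay_solution d At x u z by fact
    show ?thesis using solves in_X[of 0] x by (intro Gam_eqX) (auto simp: solves_def)
  qed
  \<comment> \<open>The upper inequality of \<open>O_set\<close>, multiplied by \<alpha>, is the
    lower control bound \<open>(1 - A / At) * y\<^sup>0 < u\<close>, and positivity of
    \<open>Gam\<close> is the upper bound \<open>u < y\<^sup>0\<close>; together they give
    \<open>y\<^sup>0 > 0\<close>.\<close>
  have in_O: "0 < Gam d \<xi> (y t)" "\<alpha> * Gam d \<xi> (y t) < A / At * fst (y t)" if "t \<ge> 0" for t
  proof -
    have "y t \<in> O_set d A At \<xi> \<alpha>" using assms that by blast
    then show "0 < Gam d \<xi> (y t)" "\<alpha> * Gam d \<xi> (y t) < A / At * fst (y t)"
      using \<alpha>_pos \<open>At > 0\<close> by (auto simp: O_set_def Q_set_def field_simps)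
  qed
  have "?u \<in> admissible d A At x"
    unfolding admissible_def
  proof (intro CollectI conjI exI[of _ y] allI impI)
    show "0 \<le> fst (y t)" if "0 \<le> t" for t
    proof -
      have "0 < \<alpha> * Gam d \<xi> (y t)" using in_O(1)[OF that] \<alpha>_pos by simp
      then have "0 < A / At * fst (y t)" using in_O(2)[OF that] by linarith
      then show ?thesis using \<open>A > 0\<close> \<open>At > 0\<close> by (simp add: zero_less_mult_iff zero_less_divide_iff)
    qed
    have "?u t \<in> {(1 - A / At) * fst (y t)..fst (y t)}" if "0 \<le> t" for t
      using in_O[OF that] \<alpha>_pos by (simp add: feedback_def left_diff_distrib)
    then show "AE t in lebesgue_on {0..}. ?u t \<in> {(1 - A / At) * fst (y t)..fst (y t)}"
      by (intro AE_I2) simp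
  qed (use u_L2loc closed.solves in auto)
  moreover have "objective d At \<rho> \<sigma> x ?u = ?v"
  proof -
    have "fst (y t) - ?u t = \<alpha> * Gam d \<xi> x * exp (\<xi> * (1 - \<alpha>) * t)" if "0 \<le> t" for t
      using closed.Gam_closed_loop[OF refl \<open>\<xi> = At * exp (- \<xi> * d)\<close> that] Gam_0[OF closed.delay_solution_axioms]
      by (simp add: feedback_def)
    then show ?thesis
      unfolding \<open>\<nu> = _\<close> by (simp only: closed.objective_eq ereal_integral_optimal_utility[OF G])
  qed
  moreover have "objective d At \<rho> \<sigma> x u \<le> ?v" if adm: "u \<in> admissible d A At x" for u
  proof -
    obtain z where u: "u \<in> L2loc" "solves d At x u z" and nonneg: "\<And>t. 0 \<le> t \<Longrightarrow> 0 \<le> fst (z t)"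
      and ae: "AE t in lebesgue_on {0..}. u t \<in> {(1 - A / At) * fst (z t)..fst (z t)}"
      using adm unfolding admissible_def by blast
    interpret other: delay_solution d At x u z
      using \<open>d > 0\<close> u by (rule delay_solutionI)
    have le: "AE t in lebesgue_on {0..}. u t \<le> fst (z t)"
      using ae by eventually_elim simp
    have "AE t in lebesgue_on {0..}. 0 \<le> fst (z t) - u t"
      using le by eventually_elim simp
    then show ?thesis
      unfolding \<open>\<nu> = _\<close> other.objective_eq[OF refl]
      using other.discounted_consumption_le[OF nonneg le \<open>\<xi> > 0\<close> \<open>\<xi> = At * exp (- \<xi> * d)\<close>]
        Gam_0[OF other.delay_solution_axioms]
      by (intro ereal_integral_utility_le[OF G other.consumption_measurable]) auto
  qed
  ultimately have "value_fun d A At \<rho> \<sigma> x = ?v"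
    unfolding value_fun_def by (intro antisym SUP_least) (auto intro: SUP_upper2)
  then show ?thesis
    using \<open>?u \<in> admissible d A At x\<close> \<open>objective d At \<rho> \<sigma> x ?u = ?v\<close> by (simp add: optimal_def)
qed

end
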